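(* Let $k$ be an algebraically closed field of characteristic $2$, let $S\subset\mathbb{P}^3_k$ be a smooth quartic surface containing a line $\ell$, and let $\pi:S\to\mathbb{P}^1$ be the genus one fibration induced by the linear system $|\mathcal{O}_S(1)-\ell|$. Then $\pi$ is not quasi-elliptic.
   Context: The fibers of $\pi$ are the residual plane cubics $C_t$ defined by $S\cap H_t=\ell+C_t$, where $H_t$ runs through the pencil of planes in $\mathbb{P}^3$ containing $\ell$. They are curves of arithmetic genus one. The fibration is called quasi-elliptic if its general fiber is singular (a cuspidal cubic). *)

theory Defs
  imports
    "HOL-Analysis.Analysis"
    "HOL-Library.Poly_Mapping"
    "HOL-Computational_Algebra.Computational_Algebra"
begin

text \<open>
  Polynomials in four variables over \<open>'k\<close>, i.e. the homogeneous coordinate ring of projective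
  3-space. A monomial is its exponent vector; the ring structure is the one of
  \<^theory>\<open>HOL-Library.Poly_Mapping\<close> (convolution product).
\<close>

type_synonym 'k poly4 = "(4 \<Rightarrow>\<^sub>0 nat) \<Rightarrow>\<^sub>0 'k"

definition eval :: "'k::comm_ring_1 poly4 \<Rightarrow> 'k ^ 4 \<Rightarrow> 'k" where
  "eval p v = (\<Sum>m\<in>Poly_Mapping.keys p.
     Poly_Mapping.lookup p m * (\<Prod>i\<in>UNIV. v $ i ^ Poly_Mapping.lookup m i))"

definition homogeneous :: "nat \<Rightarrow> 'k::comm_ring_1 poly4 \<Rightarrow> bool" where
  "homogeneous d p \<longleftrightarrow>
     (\<forall>m\<in>Poly_Mapping.keys p. (\<Sum>i\<in>UNIV. Poly_Mapping.lookup m i) = d)"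

definition partial :: "4 \<Rightarrow> 'k::comm_ring_1 poly4 \<Rightarrow> 'k poly4" where
  "partial i p = (\<Sum>m\<in>Poly_Mapping.keys p.
     Poly_Mapping.single (m - Poly_Mapping.single i 1)
       (of_nat (Poly_Mapping.lookup m i) * Poly_Mapping.lookup p m))"

text \<open>
  Points of projective 3-space are represented by nonzero vectors; lines and planes are the linear
  subspaces of \<open>'k ^ 4\<close> of dimension 2 and 3. A surface is given by its equation. Smoothness is the
  Jacobian criterion over an algebraically closed field. The equation itself is part of the
  criterion: since the characteristic may divide the degree, its vanishing does not follow
  from that of the partial derivatives. The condition forces \<open>F \<noteq> 0\<close>.
\<close>

definition smooth_quartic :: "'k::field poly4 \<Rightarrow> bool" where
  "smooth_quartic F \<longleftrightarrow> homogeneous 4 F \<and>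
     (\<forall>P. P \<noteq> 0 \<longrightarrow> \<not> (eval F P = 0 \<and> (\<forall>i. eval (partial i F) P = 0)))"

definition is_line :: "('k::field ^ 4) set \<Rightarrow> bool" where
  "is_line l \<longleftrightarrow> vec.subspace l \<and> vec.dim l = 2"

definition is_plane :: "('k::field ^ 4) set \<Rightarrow> bool" where
  "is_plane H \<longleftrightarrow> vec.subspace H \<and> vec.dim H = 3"

text \<open>The pencil of planes through \<open>l\<close>; this is the base, a projective line, of the fibration.\<close>

definition pencil :: "('k::field ^ 4) set \<Rightarrow> ('k ^ 4) set set" where
  "pencil l = {H. is_plane H \<and> l \<subseteq> H}"

text \<open>
  \<open>residual_cubic F l H Q\<close>: the plane cubic \<open>{Q = 0} \<subseteq> H\<close> is the residual curve \<open>C\<close> in the equality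
  \<open>S \<inter> H = l + C\<close> of divisors on \<open>H\<close>. With \<open>L\<close> an equation of \<open>H\<close> and \<open>M\<close> an equation of \<open>l\<close> inside
  \<open>H\<close>, this says \<open>F = M * Q\<close> in the coordinate ring of \<open>H\<close>, i.e. modulo \<open>L\<close>.
  Restricted to \<open>H\<close>, such a \<open>Q\<close> is unique up to a nonzero scalar.
\<close>

definition residual_cubic ::
    "'k::field poly4 \<Rightarrow> ('k ^ 4) set \<Rightarrow> ('k ^ 4) set \<Rightarrow> 'k poly4 \<Rightarrow> bool" where
  "residual_cubic F l H Q \<longleftrightarrow> homogeneous 3 Q \<and>
     (\<exists>L M. homogeneous 1 L \<and> homogeneous 1 M \<and>
        H = {P. eval L P = 0} \<and> l = {P \<in> H. eval M P = 0} \<and> L dvd (F - M * Q))"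

text \<open>
  The genus one fibration \<open>\<pi>\<close> induced by the linear system \<open>|O\<^sub>S(1) - l|\<close> is represented by the
  family of its scheme-theoretic fibers: the fiber over \<open>H \<in> pencil l\<close> is the corresponding member
  of the linear system, the curve \<open>{Q = 0} \<subseteq> H\<close>, recorded by the set of all its equations \<open>Q\<close>.
\<close>

definition genus_one_fibration ::
    "'k::field poly4 \<Rightarrow> ('k ^ 4) set \<Rightarrow> ('k ^ 4) set \<Rightarrow> 'k poly4 set" where
  "genus_one_fibration F l = (\<lambda>H. {Q. residual_cubic F l H Q})"

text \<open>
  The curve \<open>{Q = 0}\<close> in the plane \<open>H\<close> is singular at \<open>P\<close> iff \<open>Q\<close> vanishes at \<open>P\<close> and so do all
  derivatives of \<open>Q\<close> in the directions of \<open>H\<close> (the Jacobian criterion for the restriction of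
  \<open>Q\<close> to \<open>H\<close>).
\<close>

definition singular_at :: "('k::field ^ 4) set \<Rightarrow> 'k poly4 \<Rightarrow> 'k ^ 4 \<Rightarrow> bool" where
  "singular_at H Q P \<longleftrightarrow>
     eval Q P = 0 \<and> (\<forall>v\<in>H. (\<Sum>i\<in>UNIV. v $ i * eval (partial i Q) P) = 0)"

definition singular_plane_curve :: "('k::field ^ 4) set \<Rightarrow> 'k poly4 \<Rightarrow> bool" where
  "singular_plane_curve H Q \<longleftrightarrow> (\<exists>P\<in>H. P \<noteq> 0 \<and> singular_at H Q P)"

text \<open>
  The general fiber is singular: the fiber is singular over a nonempty Zariski open subset of the
  base \<open>B\<close>. As \<open>B\<close> is a projective line over an infinite field, these subsets are exactly the
  cofinite ones.
\<close>

definition quasi_elliptic ::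
    "('k::field ^ 4) set set \<Rightarrow> (('k ^ 4) set \<Rightarrow> 'k poly4 set) \<Rightarrow> bool" where
  "quasi_elliptic B \<pi> \<longleftrightarrow> finite {H \<in> B. \<not> (\<exists>Q\<in>\<pi> H. singular_plane_curve H Q)}"

end

theory Submission
  imports Defs
begin

text \<open>
  Let \<open>u\<^sub>0, \<dots>, u\<^sub>3\<close> be a basis such that \<open>u\<^sub>2, u\<^sub>3\<close> span \<open>l\<close>. On the plane \<open>x\<^sub>1 = t x\<^sub>0\<close> the quartic is
  \<open>x\<close> times a cubic \<open>Q\<^sub>t = \<Sum> a\<^sub>i\<^sub>j x\<^sub>i x\<^sub>j\<^sup>2 + c xyz\<close> whose coefficients are polynomials in \<open>t\<close>. In
  characteristic 2 the gradient of \<open>Q\<^sub>t\<close> is \<open>A (x\<^sup>2, y\<^sup>2, z\<^sup>2) + c (yz, xz, xy)\<close>, and a common zero of it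
  and of the \<open>t\<close>-derivative of \<open>Q\<^sub>t\<close> is a singular point of the surface.

  If \<open>c \<noteq> 0\<close>, the singular points of the general fiber are nodes. They are separable over \<open>k(t)\<close>, so
  \<open>d/dt\<close> extends to their coordinates, and differentiating \<open>Q\<^sub>t(P\<^sub>t) = 0\<close> shows that the
  \<open>t\<close>-derivative of \<open>Q\<^sub>t\<close> vanishes at \<open>P\<^sub>t\<close>.

  If \<open>c = 0\<close>, then \<open>det A = 0\<close>. A primitive kernel vector \<open>v\<close> of \<open>A\<close> over \<open>k[t]\<close> consists of the squares of
  the coordinates of the cusp. The \<open>t\<close>-derivative of \<open>Q\<^sub>t\<close> at the cusp has square
  \<open>h = \<Sum> v\<^sub>i (A' v)\<^sub>i\<^sup>2\<close>. As a form on the projective line, \<open>h\<close> has degree \<open>3e - 2\<close>, where \<open>e\<close> is the degree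
  of \<open>v\<close>, so it has a zero, possibly at infinity.
\<close>

section \<open>Nodal fibers\<close>

lemma poly_eq_0_if_infinite_roots:
  fixes f :: "'a::idom poly"
  assumes "infinite S" "\<And>t. t \<in> S \<Longrightarrow> poly f t = 0"
  shows "f = 0"
  using assms poly_roots_finite[of f] finite_subset[of S "{t. poly f t = 0}"] by blast

lemma infinite_set_nonroot:
  fixes f :: "'a::idom poly"
  assumes "infinite S" "f \<noteq> 0"
  obtains t where "t \<in> S" "poly f t \<noteq> 0"
  using assms poly_eq_0_if_infinite_roots by blast

text \<open>Squares are constants for the derivation in characteristic 2. The reductions below are
  therefore squared first: their multipliers then pass through \<open>pderiv\<close>
  unchanged.\<close>

lemma pderiv_mult_square:
  fixes r s :: "'a::idom poly"
  assumes "(2::'a) = 0"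
  shows "pderiv (r * s\<^sup>2) = pderiv r * s\<^sup>2"
proof -
  have "pderiv (s\<^sup>2) = smult 2 (s * pderiv s)"
    by (simp add: power2_eq_square pderiv_mult) (metis mult_2 smult_add_left one_add_one smult_1_left)
  thus ?thesis using assms by (simp add: pderiv_mult)
qed

lemma square_add_char2:
  fixes a b :: "'a::comm_ring_1"
  assumes "(2::'a) = 0"
  shows "(a + b)\<^sup>2 = a\<^sup>2 + b\<^sup>2"
  using assms by (simp add: power2_sum)

text \<open>
  The lemmas on \<open>conic\<close> transport a relation between \<open>Y = y\<^sup>2\<close> and \<open>Z = z\<^sup>2\<close> over \<open>k(t)\<close> to the relation
  with differentiated coefficients: modulo relations whose coefficients are squares, and hence have
  derivative 0, it is a linear relation between elements that are independent over \<open>k(t)\<close>. The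
  three lemmas treat the cases where \<open>1, y, z\<close> span a space of dimension 1, at most 2, and 3.
\<close>

definition conic :: "'a::field poly \<Rightarrow> 'a poly \<Rightarrow> 'a poly \<Rightarrow> 'a poly \<Rightarrow> 'a poly \<Rightarrow> 'a poly \<Rightarrow> 'a \<Rightarrow> 'a \<Rightarrow> 'a \<Rightarrow> 'a" where
  "conic r0 r1 r2 r3 r4 r5 t Y Z = poly r0 t + poly r1 t * Y + poly r2 t * Z
     + poly r3 t * Y\<^sup>2 + poly r4 t * (Y * Z) + poly r5 t * Z\<^sup>2"

lemma conic_deriv_rational:
  fixes r0 r1 r2 r3 r4 r5 u p q :: "'a::field poly"
  assumes two: "(2::'a) = 0" and S: "infinite S" and u: "u \<noteq> 0"
    and yz: "\<And>t. t \<in> S \<Longrightarrow> poly u t * y t = poly p t" "\<And>t. t \<in> S \<Longrightarrow> poly u t * z t = poly q t"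
    and R: "\<And>t. t \<in> S \<Longrightarrow> conic r0 r1 r2 r3 r4 r5 t ((y t)\<^sup>2) ((z t)\<^sup>2) = 0"
  shows "\<exists>t\<in>S. conic (pderiv r0) (pderiv r1) (pderiv r2) (pderiv r3) (pderiv r4) (pderiv r5) t
    ((y t)\<^sup>2) ((z t)\<^sup>2) = 0"
proof -
  \<comment> \<open>\<open>f\<close> is \<open>u^4\<close> times the conic with
    \<open>y = p/u\<close> and \<open>z = q/u\<close> inserted, arranged so that each of
    \<open>r0\<close>, ..., \<open>r5\<close> is multiplied by a square.\<close>
  define f where "f = r0 * (u^2)^2 + r1 * (u * p)^2 + r2 * (u * q)^2 + r3 * (p^2)^2 + r4 * (p * q)^2 + r5 * (q^2)^2"
  have "poly f t = poly u t ^ 4 * conic r0 r1 r2 r3 r4 r5 t ((y t)\<^sup>2) ((z t)\<^sup>2)" if "t \<in> S" for t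
    unfolding f_def conic_def using yz[OF that, symmetric]
    by (simp add: algebra_simps power2_eq_square numeral_eq_Suc)
  hence "f = 0" using R by (intro poly_eq_0_if_infinite_roots[OF S]) simp
  hence f': "pderiv f = 0" by simp
  obtain t where t: "t \<in> S" "poly u t \<noteq> 0" using infinite_set_nonroot[OF S u] .
  have "poly (pderiv f) t = poly u t ^ 4 * conic (pderiv r0) (pderiv r1) (pderiv r2) (pderiv r3) (pderiv r4) (pderiv r5) t ((y t)\<^sup>2) ((z t)\<^sup>2)"
    unfolding f_def conic_def pderiv_add pderiv_mult_square[OF two] using yz[OF t(1), symmetric]
    by (simp add: algebra_simps power2_eq_square numeral_eq_Suc)
  thus ?thesis using f' t by auto
qed

lemma conic_deriv_linear:
  fixes r0 r1 r2 r3 r4 r5 u p q c \<beta>0 \<beta>1 \<beta>2 :: "'a::field poly"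
  assumes two: "(2::'a) = 0" and S: "infinite S" and u: "u \<noteq> 0" and c: "c \<noteq> 0"
    and yz: "\<And>t. t \<in> S \<Longrightarrow> poly u t * z t = poly p t + poly q t * y t"
    and E2: "\<And>t. t \<in> S \<Longrightarrow> poly c t * y t = poly \<beta>0 t + poly \<beta>1 t * (y t)\<^sup>2 + poly \<beta>2 t * (z t)\<^sup>2"
    and R: "\<And>t. t \<in> S \<Longrightarrow> conic r0 r1 r2 r3 r4 r5 t ((y t)\<^sup>2) ((z t)\<^sup>2) = 0"
  shows "\<exists>t\<in>S. conic (pderiv r0) (pderiv r1) (pderiv r2) (pderiv r3) (pderiv r4) (pderiv r5) t
    ((y t)\<^sup>2) ((z t)\<^sup>2) = 0"
proof -
  \<comment> \<open>Squaring \<open>u z = p + q y\<close> makes \<open>u^2 Z\<close> affine in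
    \<open>Y = y^2\<close>. Inserted in the relation for \<open>c y\<close>, this gives
    \<open>u^2 c y = e0 + e1 Y\<close>.\<close>
  define e0 where "e0 = u^2 * \<beta>0 + \<beta>2 * p^2"
  define e1 where "e1 = u^2 * \<beta>1 + \<beta>2 * q^2"
  have Z: "poly u t ^ 2 * (z t)^2 = poly p t ^ 2 + poly q t ^ 2 * (y t)^2" if "t \<in> S" for t
    using arg_cong[OF yz[OF that], of "\<lambda>x. x^2"] by (simp add: square_add_char2[OF two] power_mult_distrib)
  have y: "poly (u^2 * c) t * y t = poly e0 t + poly e1 t * (y t)^2" if "t \<in> S" for t
    unfolding e0_def e1_def using Z[OF that] E2[OF that] by (simp) algebra
  have elim: "u * U * z = p * U + q * P" if "U * y = P" "u * z = p + q * y" for u U y z p q P :: 'a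
  proof -
    have "u * U * z = U * (u * z)" by simp
    also have "\<dots> = p * U + q * (U * y)" unfolding that(2) by (simp add: algebra_simps)
    finally show ?thesis unfolding that(1) .
  qed
  show ?thesis
  proof (cases "e1 = 0")
    case True
    have "u * (u^2 * c) \<noteq> 0" using u c by simp
    moreover have "poly (u * (u^2 * c)) t * y t = poly (u * e0) t" if "t \<in> S" for t
      using y[OF that] True by (simp add: algebra_simps)
    moreover have "poly (u * (u^2 * c)) t * z t = poly (p * (u^2 * c) + q * e0) t" if "t \<in> S" for t
      using elim[OF _ yz[OF that], of "poly (u^2 * c) t" "poly e0 t"] y[OF that] True by simp
    ultimately show ?thesis using conic_deriv_rational[OF two S _ _ _ R] by blast
  next
    case e1: False
    \<comment> \<open>Squaring once more gives a quadratic equation for \<open>Y\<close> whose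
      coefficients are all squares.\<close>
    have y2: "poly (e1^2) t * ((y t)\<^sup>2)\<^sup>2 = poly ((u^2 * c)^2) t * (y t)\<^sup>2 + poly (e0^2) t" if "t \<in> S" for t
    proof -
      have "poly e1 t * (y t)\<^sup>2 = poly (u^2 * c) t * y t + - poly e0 t" using y[OF that] by simp
      hence "(poly e1 t * (y t)\<^sup>2)\<^sup>2 = (poly (u^2 * c) t * y t)\<^sup>2 + (- poly e0 t)\<^sup>2"
        unfolding square_add_char2[OF two, symmetric] by (rule arg_cong)
      thus ?thesis by (simp add: power_mult_distrib)
    qed
    \<comment> \<open>\<open>f0 + f1 Y\<close> is the conic times \<open>(e1 u^2)^2\<close> after
      \<open>Z\<close> and \<open>Y^2\<close> have been eliminated.\<close>
    define f0 where "f0 = r0 * (e1 * u^2)^2 + r2 * (e1 * u * p)^2 + r5 * (e1 * p^2)^2 + r3 * (e0 * u^2)^2 + r4 * (e0 * u * q)^2 + r5 * (e0 * q^2)^2"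
    define f1 where "f1 = r1 * (e1 * u^2)^2 + r2 * (e1 * u * q)^2 + r4 * (e1 * u * p)^2
       + r3 * (u^2 * c * u^2)^2 + r4 * (u^2 * c * u * q)^2 + r5 * (u^2 * c * q^2)^2"
    \<comment> \<open>The elimination is stated for arbitrary values in place of \<open>r0\<close>,
      ..., \<open>r5\<close>, since it serves both for these coefficients and for their
      derivatives.\<close>
    have key: "r0 * (E * U * U)+ (r1 * (E * U * U)+(r2 * (E * (U * q2)) + (r4 * (E * (U * p2)) + (r3 * (C * (U * U)) + (r4 * (C * (U * q2)) + r5 * (C * (q2 * q2))))))) * Y
         + r2 * (E * (U * p2)) + r5 * (E * (p2 * p2)) + r3 * (E0 * (U * U)) + r4 * (E0 * (U * q2)) + r5 * (E0 * (q2 * q2)) = E * (U * U) * (r0+r1 * Y+r2 * Z+r3 * Y^2+r4 * (Y * Z)+r5 * Z^2)"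
      if "U * Z = p2+q2 * Y" "E * Y^2=C * Y+E0" for r0 r1 r2 r3 r4 r5 E U C p2 q2 E0 Y Z :: 'a
    proof -
      have 1: "(U * Z)^2 = p2^2+q2^2 * Y^2"
        by (simp add: that(1) square_add_char2[OF two] power_mult_distrib)
      have "E * (U * U) * (r0+r1 * Y+r2 * Z+r3 * Y^2+r4 * (Y * Z)+r5 * Z^2)
        = r0 * (E * U * U)+r1 * (E * U * U) * Y + r2 * (E * U * (U * Z)) + r3 * (U * U) * (E * Y^2) + r4 * (E * U * Y * (U * Z)) + r5 * E * (U * Z)^2"
        by (simp add: algebra_simps power2_eq_square)
      also have "\<dots> = r0 * (E * U * U)+r1 * (E * U * U) * Y + r2 * (E * U * (p2+q2 * Y)) + r3 * (U * U) * (C * Y+E0) + r4 * (E * U * Y * p2+U * q2 * (E * Y^2)) + r5 * (E * p2^2+q2^2 * (E * Y^2))"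
        unfolding 1 that(1) that(2)[symmetric] by (simp add: two algebra_simps power2_eq_square)
      finally show ?thesis unfolding that(2) by (simp add: algebra_simps power2_eq_square)
    qed
    have f: "poly f0 t + poly f1 t * (y t)\<^sup>2 = poly ((e1 * u^2)^2) t * conic r0 r1 r2 r3 r4 r5 t ((y t)\<^sup>2) ((z t)\<^sup>2)"
      if "t \<in> S" for t
      using key[OF Z[OF that] y2[OF that], of "poly r0 t" "poly r1 t" "poly r2 t" "poly r4 t" "poly r3 t" "poly r5 t"]
      unfolding conic_def f0_def f1_def
      by (simp add: algebra_simps power2_eq_square)
    have fd: "poly (pderiv f0) t + poly (pderiv f1) t * (y t)\<^sup>2 = poly ((e1 * u^2)^2) t *
       conic (pderiv r0) (pderiv r1) (pderiv r2) (pderiv r3) (pderiv r4) (pderiv r5) t ((y t)\<^sup>2) ((z t)\<^sup>2)"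
      if "t \<in> S" for t
      using key[OF Z[OF that] y2[OF that], of "poly (pderiv r0) t" "poly (pderiv r1) t" "poly (pderiv r2) t" "poly (pderiv r4) t" "poly (pderiv r3) t" "poly (pderiv r5) t"]
      unfolding conic_def f0_def f1_def pderiv_add pderiv_mult_square[OF two]
      by (simp add: algebra_simps power2_eq_square)
    have f_0: "poly f0 t + poly f1 t * (y t)\<^sup>2 = 0" if "t \<in> S" for t
      using f[OF that] R[OF that] by simp
    show ?thesis
    proof (cases "f1 = 0")
      case False
      \<comment> \<open>As \<open>f1\<close> is nonzero, \<open>f0 + f1 Y = 0\<close> makes
        \<open>Y\<close> rational. Then \<open>u^2 c y = e0 + e1 Y\<close> makes \<open>y\<close>
        rational too, with denominator \<open>U\<close>.\<close>
      define U P where "U = f1 * (u^2 * c)" and "P = f1 * e0 - e1 * f0"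
      have U: "u * U \<noteq> 0" using u c False by (simp add: U_def)
      have UP: "poly U t * y t = poly P t" if "t \<in> S" for t
        unfolding U_def P_def using y[OF that] f_0[OF that] by simp algebra
      have "poly (u * U) t * y t = poly (u * P) t" if "t \<in> S" for t
        using UP[OF that] by (simp add: algebra_simps)
      moreover have "poly (u * U) t * z t = poly (p * U + q * P) t" if "t \<in> S" for t
        using elim[OF UP[OF that] yz[OF that]] by simp
      ultimately show ?thesis using conic_deriv_rational[OF two S U _ _ R] by blast
    next
      case True
      have "f0 = 0" using f_0 True by (intro poly_eq_0_if_infinite_roots[OF S]) simp
      moreover obtain t where t: "t \<in> S" "poly (e1 * u) t \<noteq> 0"
        using infinite_set_nonroot[OF S, of "e1 * u"] e1 u by auto
      ultimately show ?thesis using fd[OF t(1)] True t by auto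
    qed
  qed
qed

lemma conic_deriv_generic:
  fixes r0 r1 r2 r3 r4 r5 c d b1 b2 \<alpha>0 \<alpha>1 \<alpha>2 \<beta>0 \<beta>1 \<beta>2 :: "'a::field poly"
  assumes two: "(2::'a) = 0" and S: "infinite S" and c: "c \<noteq> 0"
    and E1: "\<And>t. t \<in> S \<Longrightarrow> poly c t * z t = poly \<alpha>0 t + poly \<alpha>1 t * (y t)\<^sup>2 + poly \<alpha>2 t * (z t)\<^sup>2"
    and E2: "\<And>t. t \<in> S \<Longrightarrow> poly c t * y t = poly \<beta>0 t + poly \<beta>1 t * (y t)\<^sup>2 + poly \<beta>2 t * (z t)\<^sup>2"
    and E3: "\<And>t. t \<in> S \<Longrightarrow> poly c t * (y t * z t) = poly d t + poly b1 t * (y t)\<^sup>2 + poly b2 t * (z t)\<^sup>2"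
    and R: "\<And>t. t \<in> S \<Longrightarrow> conic r0 r1 r2 r3 r4 r5 t ((y t)\<^sup>2) ((z t)\<^sup>2) = 0"
    and indep: "\<And>\<rho>0 \<rho>1 \<rho>2. (\<forall>t\<in>S. poly \<rho>0 t + poly \<rho>1 t * y t + poly \<rho>2 t * z t = 0) \<Longrightarrow> \<rho>1 = 0 \<and> \<rho>2 = 0"
  shows "\<exists>t\<in>S. conic (pderiv r0) (pderiv r1) (pderiv r2) (pderiv r3) (pderiv r4) (pderiv r5) t
    ((y t)\<^sup>2) ((z t)\<^sup>2) = 0"
proof -
  \<comment> \<open>\<open>D\<close> is the determinant of the two linear equations for
    \<open>Y\<close> and \<open>Z\<close>; \<open>DY\<close> and \<open>DZ\<close> are Cramer's
    rule.\<close>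
  define D where "D = \<alpha>1 * \<beta>2 - \<alpha>2 * \<beta>1"
  have DY: "poly D t * (y t)\<^sup>2 = poly \<beta>2 t * (poly c t * z t - poly \<alpha>0 t) - poly \<alpha>2 t * (poly c t * y t - poly \<beta>0 t)" if "t \<in> S" for t
    unfolding D_def using E1[OF that] E2[OF that] by (simp add: algebra_simps)
  have DZ: "poly D t * (z t)\<^sup>2 = poly \<alpha>1 t * (poly c t * y t - poly \<beta>0 t) - poly \<beta>1 t * (poly c t * z t - poly \<alpha>0 t)" if "t \<in> S" for t
    unfolding D_def using E1[OF that] E2[OF that] by (simp add: algebra_simps)
  \<comment> \<open>For \<open>D = 0\<close>, Cramer's rule becomes two linear relations between
    \<open>1\<close>, \<open>y\<close>, \<open>z\<close>. Independence makes the coefficients of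
    \<open>Y\<close> and \<open>Z\<close> in \<open>E1\<close> and \<open>E2\<close> vanish, and
    then \<open>c z = \<alpha>0\<close> is itself a forbidden relation.\<close>
  have D: "D \<noteq> 0"
  proof
    assume D0: "D = 0"
    have "poly (\<alpha>2 * \<beta>0 - \<beta>2 * \<alpha>0) t + poly (-\<alpha>2 * c) t * y t + poly (\<beta>2 * c) t * z t = 0" if "t \<in> S" for t
      using DY[OF that, unfolded D0] by simp algebra
    hence *: "\<alpha>2 = 0" "\<beta>2 = 0" using indep c by (metis mult_eq_0_iff neg_equal_0_iff_equal)+
    have "poly (\<beta>1 * \<alpha>0 - \<alpha>1 * \<beta>0) t + poly (\<alpha>1 * c) t * y t + poly (-\<beta>1 * c) t * z t = 0" if "t \<in> S" for t
      using DZ[OF that, unfolded D0] by simp algebra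
    hence "\<alpha>1 = 0" "\<beta>1 = 0" using indep c by (metis mult_eq_0_iff neg_equal_0_iff_equal)+
    hence "poly (-\<alpha>0) t + poly 0 t * y t + poly c t * z t = 0" if "t \<in> S" for t
      using E1[OF that] * by simp
    thus False using indep c by blast
  qed
  \<comment> \<open>These are the coordinates of \<open>D Y\<close> and \<open>D Z\<close> with
    respect to \<open>1\<close>, \<open>y\<close>, \<open>z\<close>. Squaring expresses
    \<open>Y^2\<close> and \<open>Z^2\<close> through \<open>1\<close>, \<open>Y\<close>,
    \<open>Z\<close> with square coefficients; the square of \<open>E3\<close> then does the same
    for \<open>Y Z\<close>.\<close>
  define k0 ky kz where "k0 = \<alpha>2 * \<beta>0 - \<beta>2 * \<alpha>0" and "ky = -\<alpha>2 * c" and "kz = \<beta>2 * c"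
  define l0 ly lz where "l0 = \<beta>1 * \<alpha>0 - \<alpha>1 * \<beta>0" and "ly = \<alpha>1 * c" and "lz = -\<beta>1 * c"
  have Y2: "poly D t ^ 2 * ((y t)\<^sup>2)^2 = poly k0 t ^ 2 + poly ky t ^ 2 * (y t)^2 + poly kz t ^2 * (z t)^2" if "t \<in> S" for t
  proof -
    have "poly D t * (y t)\<^sup>2 = poly k0 t + poly ky t * y t + poly kz t * z t"
      unfolding k0_def ky_def kz_def DY[OF that] by (simp add: algebra_simps)
    from arg_cong[OF this, of "\<lambda>x. x\<^sup>2"] show ?thesis
      by (simp add: square_add_char2[OF two] power_mult_distrib)
  qed
  have Z2: "poly D t ^ 2 * ((z t)\<^sup>2)^2 = poly l0 t ^ 2 + poly ly t ^ 2 * (y t)^2 + poly lz t ^2 * (z t)^2" if "t \<in> S" for t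
  proof -
    have "poly D t * (z t)\<^sup>2 = poly l0 t + poly ly t * y t + poly lz t * z t"
      unfolding l0_def ly_def lz_def DZ[OF that] by (simp add: algebra_simps)
    from arg_cong[OF this, of "\<lambda>x. x\<^sup>2"] show ?thesis
      by (simp add: square_add_char2[OF two] power_mult_distrib)
  qed
  have YZ: "poly c t ^ 2 * ((y t)\<^sup>2 * (z t)\<^sup>2) = poly d t ^ 2 + poly b1 t ^ 2 * ((y t)\<^sup>2)^2 + poly b2 t ^2 * ((z t)\<^sup>2)^2" if "t \<in> S" for t
    using arg_cong[OF E3[OF that], of "\<lambda>x. x\<^sup>2"]
    by (simp add: square_add_char2[OF two] power_mult_distrib)
  define m0 my mz where "m0 = D * d + b1 * k0 + b2 * l0" and "my = b1 * ky+b2 * ly" and "mz = b1 * kz+b2 * lz"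
  have YZ2: "poly (D * c) t ^ 2 * ((y t)\<^sup>2 * (z t)\<^sup>2) = poly m0 t ^ 2 + poly my t ^ 2 * (y t)^2 + poly mz t ^2 * (z t)^2" if "t \<in> S" for t
  proof -
    have "poly (D * c) t ^ 2 * ((y t)\<^sup>2 * (z t)\<^sup>2) = (poly D t * poly d t)\<^sup>2
        + (poly b1 t)\<^sup>2 * ((poly D t)\<^sup>2 * ((y t)\<^sup>2)\<^sup>2) + (poly b2 t)\<^sup>2 * ((poly D t)\<^sup>2 * ((z t)\<^sup>2)\<^sup>2)"
      using YZ[OF that] by (simp add: power_mult_distrib algebra_simps)
    thus ?thesis unfolding Y2[OF that] Z2[OF that] m0_def my_def mz_def
      by (simp add: square_add_char2[OF two] power_mult_distrib algebra_simps)
  qed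
  \<comment> \<open>\<open>g0 + g1 Y + g2 Z\<close> is the conic times \<open>(D c)^2\<close>,
    reduced by these formulas. All multipliers are squares, so the derivatives of the coefficients
    reduce in the same way.\<close>
  define g0 where "g0 = r0 * (D * c)^2 + r3 * (c * k0)^2 + r4 * m0^2 + r5 * (c * l0)^2"
  define g1 where "g1 = r1 * (D * c)^2 + r3 * (c * ky)^2 + r4 * my^2 + r5 * (c * ly)^2"
  define g2 where "g2 = r2 * (D * c)^2 + r3 * (c * kz)^2 + r4 * mz^2 + r5 * (c * lz)^2"
  have g: "poly g0 t + poly g1 t * (y t)\<^sup>2 + poly g2 t * (z t)^2 = poly (D * c) t ^ 2 * conic r0 r1 r2 r3 r4 r5 t ((y t)\<^sup>2) ((z t)\<^sup>2)"
    if "t \<in> S" for t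
    unfolding conic_def g0_def g1_def g2_def using YZ2[OF that] Z2[OF that] Y2[OF that] by simp algebra
  have gd: "poly (pderiv g0) t + poly (pderiv g1) t * (y t)\<^sup>2 + poly (pderiv g2) t * (z t)^2 = poly (D * c) t ^ 2 *
      conic (pderiv r0) (pderiv r1) (pderiv r2) (pderiv r3) (pderiv r4) (pderiv r5) t ((y t)\<^sup>2) ((z t)\<^sup>2)"
    if "t \<in> S" for t
    unfolding conic_def g0_def g1_def g2_def pderiv_add pderiv_mult_square[OF two]
    using YZ2[OF that] Z2[OF that] Y2[OF that] by simp algebra
  have g_0: "poly g0 t + poly g1 t * (y t)\<^sup>2 + poly g2 t * (z t)^2 = 0" if "t \<in> S" for t
    using g[OF that] R[OF that] by simp
  \<comment> \<open>Cramer's rule turns the reduced relation into a linear one between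
    \<open>1\<close>, \<open>y\<close>, \<open>z\<close>. Independence leaves two homogeneous
    equations for \<open>g1\<close> and \<open>g2\<close>, whose determinant is \<open>D\<close> up
    to sign.\<close>
  have "poly (D * g0 + g1 * (\<alpha>2 * \<beta>0 - \<beta>2 * \<alpha>0) + g2 * (\<beta>1 * \<alpha>0 - \<alpha>1 * \<beta>0)) t + poly (c * (g2 * \<alpha>1 - g1 * \<alpha>2)) t * y t + poly (c * (g1 * \<beta>2 - g2 * \<beta>1)) t * z t = 0" if "t \<in> S" for t
    using g_0[OF that] DY[OF that] DZ[OF that] by simp algebra
  hence "c * (g2 * \<alpha>1 - g1 * \<alpha>2) = 0 \<and> c * (g1 * \<beta>2 - g2 * \<beta>1) = 0"
    by (intro indep) blast
  hence *: "g2 * \<alpha>1 - g1 * \<alpha>2 = 0" "g1 * \<beta>2 - g2 * \<beta>1 = 0" using c by auto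
  have "D * g1 = 0" "D * g2 = 0" unfolding D_def using * by algebra+
  hence g12: "g1 = 0" "g2 = 0" using D by auto
  hence "g0 = 0" using g_0 by (intro poly_eq_0_if_infinite_roots[OF S]) simp
  moreover obtain t where t: "t \<in> S" "poly (D * c) t \<noteq> 0"
    using infinite_set_nonroot[OF S, of "D * c"] D c by auto
  ultimately show ?thesis using gd[OF t(1)] g12 t by auto
qed


text \<open>The equations \<open>E1\<close> to \<open>E3\<close> say that \<open>(1, y, z)\<close>
  is a critical point, solved for the mixed terms. The product of the first two and \<open>c\<close>
  times the third both equal \<open>c^2 y z\<close>, which leaves a conic in the squares of
  \<open>y\<close> and \<open>z\<close>. Differentiating its coefficients and dividing by
  \<open>c\<close> gives the claim. The functions \<open>y\<close> and \<open>z\<close> are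
  arbitrary choices: dependence over the function field means a polynomial relation valid on the
  whole infinite set.\<close>

lemma nodal_affine:
  fixes c d b1 b2 \<alpha>0 \<alpha>1 \<alpha>2 \<beta>0 \<beta>1 \<beta>2 :: "'a::field poly"
  assumes two: "(2::'a) = 0" and S: "infinite S" and c: "c \<noteq> 0"
    and E1: "\<And>t. t \<in> S \<Longrightarrow> poly c t * z t = poly \<alpha>0 t + poly \<alpha>1 t * (y t)\<^sup>2 + poly \<alpha>2 t * (z t)\<^sup>2"
    and E2: "\<And>t. t \<in> S \<Longrightarrow> poly c t * y t = poly \<beta>0 t + poly \<beta>1 t * (y t)\<^sup>2 + poly \<beta>2 t * (z t)\<^sup>2"
    and E3: "\<And>t. t \<in> S \<Longrightarrow> poly c t * (y t * z t) = poly d t + poly b1 t * (y t)\<^sup>2 + poly b2 t * (z t)\<^sup>2"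
  shows "\<exists>t\<in>S. poly (pderiv d) t + poly (pderiv b1) t * (y t)\<^sup>2 + poly (pderiv b2) t * (z t)\<^sup>2
     + y t * (poly (pderiv \<alpha>0) t + poly (pderiv \<alpha>1) t * (y t)\<^sup>2 + poly (pderiv \<alpha>2) t * (z t)\<^sup>2)
     + z t * (poly (pderiv \<beta>0) t + poly (pderiv \<beta>1) t * (y t)\<^sup>2 + poly (pderiv \<beta>2) t * (z t)\<^sup>2)
     + poly (pderiv c) t * (y t * z t) = 0"
proof -
  \<comment> \<open>A factor \<open>c\<close> is cancelled at the end, so its zeros are left out
    from the start.\<close>
  define S' where "S' = {t\<in>S. poly c t \<noteq> 0}"
  have S': "infinite S'"
  proof
    assume "finite S'"
    hence "infinite (S - S')" using S by auto
    hence "c = 0" by (rule poly_eq_0_if_infinite_roots) (auto simp: S'_def)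
    thus False using c by simp
  qed
  \<comment> \<open>the conic \<open>(c z) (c y) + c (c y z)\<close>, which is 0 in characteristic 2\<close>
  define r0 r1 r2 r3 r4 r5 where "r0 = \<alpha>0 * \<beta>0 + c * d" and "r1 = \<alpha>0 * \<beta>1 + \<alpha>1 * \<beta>0 + c * b1"
    and "r2 = \<alpha>0 * \<beta>2 + \<alpha>2 * \<beta>0 + c * b2" and "r3 = \<alpha>1 * \<beta>1" and "r4 = \<alpha>1 * \<beta>2 + \<alpha>2 * \<beta>1" and "r5 = \<alpha>2 * \<beta>2"
  note r_defs = r0_def r1_def r2_def r3_def r4_def r5_def
  have char2: "a + a = 0" for a :: 'a using two by (metis mult_2 mult_zero_left)
  have R: "conic r0 r1 r2 r3 r4 r5 t ((y t)\<^sup>2) ((z t)\<^sup>2) = 0" if "t \<in> S'" for t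
  proof -
    have t: "t \<in> S" using that by (simp add: S'_def)
    have "conic r0 r1 r2 r3 r4 r5 t ((y t)\<^sup>2) ((z t)\<^sup>2) = (poly c t * z t) * (poly c t * y t)
        + poly c t * (poly c t * (y t * z t))"
      unfolding conic_def r_defs E1[OF t] E2[OF t] E3[OF t] by (simp add: algebra_simps power2_eq_square)
    also have "\<dots> = (poly c t)\<^sup>2 * (y t * z t) + (poly c t)\<^sup>2 * (y t * z t)"
      by (simp add: algebra_simps power2_eq_square)
    finally show ?thesis by (simp only: char2)
  qed
  have "\<exists>t\<in>S'. conic (pderiv r0) (pderiv r1) (pderiv r2) (pderiv r3) (pderiv r4) (pderiv r5) t
    ((y t)\<^sup>2) ((z t)\<^sup>2) = 0"
  proof (cases "\<forall>\<rho>0 \<rho>1 \<rho>2. (\<forall>t\<in>S'. poly \<rho>0 t + poly \<rho>1 t * y t + poly \<rho>2 t * z t = 0) \<longrightarrow> \<rho>1 = 0 \<and> \<rho>2 = 0")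
    case True
    show ?thesis
      by (rule conic_deriv_generic[OF two S' c, of z \<alpha>0 \<alpha>1 y \<alpha>2 \<beta>0 \<beta>1 \<beta>2 d b1 b2])
         (use E1 E2 E3 R True in \<open>auto simp: S'_def\<close>)
  next
    case False
    then obtain \<rho>0 \<rho>1 \<rho>2 where \<rho>: "\<And>t. t \<in> S' \<Longrightarrow> poly \<rho>0 t + poly \<rho>1 t * y t + poly \<rho>2 t * z t = 0" "\<rho>1 \<noteq> 0 \<or> \<rho>2 \<noteq> 0"
      by blast
    show ?thesis
    proof (cases "\<rho>2 = 0")
      case False
      have "poly \<rho>2 t * z t = poly (-\<rho>0) t + poly (-\<rho>1) t * y t" if "t \<in> S'" for t
        using \<rho>(1)[OF that] unfolding poly_minus by algebra
      thus ?thesis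
        by (rule conic_deriv_linear[OF two S' False c]) (use E2 R in \<open>auto simp: S'_def\<close>)
    next
      \<comment> \<open>Now \<open>y\<close> is rational. The conic is symmetric under exchanging
        \<open>y\<close> and \<open>z\<close> together with its coefficients, so the previous case
        applies with the roles exchanged.\<close>
      case True
      hence "\<rho>1 \<noteq> 0" using \<rho> by simp
      have "poly \<rho>1 t * y t = poly (-\<rho>0) t + poly 0 t * z t" if "t \<in> S'" for t
        using \<rho>(1)[OF that] True by (simp add: eq_neg_iff_add_eq_0 add_ac)
      hence "\<exists>t\<in>S'. conic (pderiv r0) (pderiv r2) (pderiv r1) (pderiv r5) (pderiv r4) (pderiv r3) t
          ((z t)\<^sup>2) ((y t)\<^sup>2) = 0"
        by (rule conic_deriv_linear[OF two S' \<open>\<rho>1 \<noteq> 0\<close> c, of _ _ _ _ \<alpha>0 \<alpha>2 \<alpha>1])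
           (use E1 R in \<open>auto simp: S'_def conic_def algebra_simps\<close>)
      thus ?thesis by (simp add: conic_def algebra_simps)
    qed
  qed
  then obtain t where t: "t \<in> S" "poly c t \<noteq> 0"
    and "conic (pderiv r0) (pderiv r1) (pderiv r2) (pderiv r3) (pderiv r4) (pderiv r5) t ((y t)\<^sup>2) ((z t)\<^sup>2) = 0"
    by (auto simp: S'_def)
  \<comment> \<open>This is the product rule for \<open>r0\<close>, ..., \<open>r5\<close>,
    regrouped. The undifferentiated sums are \<open>c z\<close>, \<open>c y\<close> and
    \<open>c y z\<close>, so that \<open>c\<close> comes out as a common factor.\<close>
  hence "0 = (poly \<alpha>0 t + poly \<alpha>1 t * (y t)\<^sup>2 + poly \<alpha>2 t * (z t)\<^sup>2)
         * (poly (pderiv \<beta>0) t + poly (pderiv \<beta>1) t * (y t)\<^sup>2 + poly (pderiv \<beta>2) t * (z t)\<^sup>2)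
       + (poly \<beta>0 t + poly \<beta>1 t * (y t)\<^sup>2 + poly \<beta>2 t * (z t)\<^sup>2)
         * (poly (pderiv \<alpha>0) t + poly (pderiv \<alpha>1) t * (y t)\<^sup>2 + poly (pderiv \<alpha>2) t * (z t)\<^sup>2)
       + poly (pderiv c) t * (poly d t + poly b1 t * (y t)\<^sup>2 + poly b2 t * (z t)\<^sup>2)
       + poly c t * (poly (pderiv d) t + poly (pderiv b1) t * (y t)\<^sup>2 + poly (pderiv b2) t * (z t)\<^sup>2)"
    unfolding conic_def r_defs by (simp add: pderiv_add pderiv_mult algebra_simps power2_eq_square)
  also have "\<dots> = poly c t * (poly (pderiv d) t + poly (pderiv b1) t * (y t)\<^sup>2 + poly (pderiv b2) t * (z t)\<^sup>2
     + y t * (poly (pderiv \<alpha>0) t + poly (pderiv \<alpha>1) t * (y t)\<^sup>2 + poly (pderiv \<alpha>2) t * (z t)\<^sup>2)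
     + z t * (poly (pderiv \<beta>0) t + poly (pderiv \<beta>1) t * (y t)\<^sup>2 + poly (pderiv \<beta>2) t * (z t)\<^sup>2)
     + poly (pderiv c) t * (y t * z t))"
    unfolding E1[OF t(1), symmetric] E2[OF t(1), symmetric] E3[OF t(1), symmetric]
    by (simp add: algebra_simps)
  finally show ?thesis using t by (metis mult_eq_0_iff)
qed

text \<open>
  \<open>cubic_critical\<close> is the vanishing of the gradient of \<open>cubic_form\<close> in characteristic 2, where \<open>aij\<close> is the
  coefficient of \<open>x\<^sub>i x\<^sub>j\<^sup>2\<close>.
\<close>

definition cubic_critical :: "'a::field \<Rightarrow> 'a \<Rightarrow> 'a \<Rightarrow> 'a \<Rightarrow> 'a \<Rightarrow> 'a \<Rightarrow> 'a \<Rightarrow> 'a \<Rightarrow> 'a \<Rightarrow> 'a \<Rightarrow> 'a \<Rightarrow> 'a \<Rightarrow> 'a \<Rightarrow> bool" where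
  "cubic_critical a11 a12 a13 a21 a22 a23 a31 a32 a33 c x y z \<longleftrightarrow>
     a11 * x\<^sup>2 + a12 * y\<^sup>2 + a13 * z\<^sup>2 + c * (y * z) = 0 \<and>
     a21 * x\<^sup>2 + a22 * y\<^sup>2 + a23 * z\<^sup>2 + c * (x * z) = 0 \<and>
     a31 * x\<^sup>2 + a32 * y\<^sup>2 + a33 * z\<^sup>2 + c * (x * y) = 0"

definition cubic_form :: "'a::field \<Rightarrow> 'a \<Rightarrow> 'a \<Rightarrow> 'a \<Rightarrow> 'a \<Rightarrow> 'a \<Rightarrow> 'a \<Rightarrow> 'a \<Rightarrow> 'a \<Rightarrow> 'a \<Rightarrow> 'a \<Rightarrow> 'a \<Rightarrow> 'a \<Rightarrow> 'a" where
  "cubic_form a11 a12 a13 a21 a22 a23 a31 a32 a33 c x y z =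
     x * (a11 * x\<^sup>2 + a12 * y\<^sup>2 + a13 * z\<^sup>2) +
     y * (a21 * x\<^sup>2 + a22 * y\<^sup>2 + a23 * z\<^sup>2) +
     z * (a31 * x\<^sup>2 + a32 * y\<^sup>2 + a33 * z\<^sup>2) + c * (x * y * z)"

lemma nodal_chart:
  fixes a11 a12 a13 a21 a22 a23 a31 a32 a33 c :: "'a::field poly"
  assumes two: "(2::'a) = 0" and S: "infinite S" and c: "c \<noteq> 0"
    and sing: "\<And>t. t \<in> S \<Longrightarrow> \<exists>x y z. x \<noteq> 0 \<and> cubic_critical (poly a11 t) (poly a12 t) (poly a13 t) (poly a21 t)
      (poly a22 t) (poly a23 t) (poly a31 t) (poly a32 t) (poly a33 t) (poly c t) x y z"
  shows "\<exists>t x y z. x \<noteq> 0 \<and> cubic_critical (poly a11 t) (poly a12 t) (poly a13 t) (poly a21 t)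
      (poly a22 t) (poly a23 t) (poly a31 t) (poly a32 t) (poly a33 t) (poly c t) x y z \<and>
      cubic_form (poly (pderiv a11) t) (poly (pderiv a12) t) (poly (pderiv a13) t) (poly (pderiv a21) t)
      (poly (pderiv a22) t) (poly (pderiv a23) t) (poly (pderiv a31) t) (poly (pderiv a32) t)
      (poly (pderiv a33) t) (poly (pderiv c) t) x y z = 0"
proof -
  have neg: "- a = a" for a :: 'a using two
    by (metis add_eq_0_iff mult_2 mult_zero_left)
  have "\<exists>y z. cubic_critical (poly a11 t) (poly a12 t) (poly a13 t) (poly a21 t)
      (poly a22 t) (poly a23 t) (poly a31 t) (poly a32 t) (poly a33 t) (poly c t) 1 y z" if t: "t \<in> S" for t
  proof -
    obtain x y z where xyz: "x \<noteq> 0" "cubic_critical (poly a11 t) (poly a12 t) (poly a13 t) (poly a21 t)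
      (poly a22 t) (poly a23 t) (poly a31 t) (poly a32 t) (poly a33 t) (poly c t) x y z"
      using sing[OF t] by blast
    have "cubic_critical (poly a11 t) (poly a12 t) (poly a13 t) (poly a21 t)
      (poly a22 t) (poly a23 t) (poly a31 t) (poly a32 t) (poly a33 t) (poly c t) 1 (y/x) (z/x)"
      using xyz unfolding cubic_critical_def by (simp add: field_simps power2_eq_square)
    thus ?thesis by blast
  qed
  then obtain y z where yz: "\<And>t. t \<in> S \<Longrightarrow> cubic_critical (poly a11 t) (poly a12 t) (poly a13 t) (poly a21 t)
      (poly a22 t) (poly a23 t) (poly a31 t) (poly a32 t) (poly a33 t) (poly c t) 1 (y t) (z t)"
    by metis
  obtain t where "t \<in> S" "poly (pderiv a11) t + poly (pderiv a12) t * (y t)\<^sup>2 + poly (pderiv a13) t * (z t)\<^sup>2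
     + y t * (poly (pderiv a21) t + poly (pderiv a22) t * (y t)\<^sup>2 + poly (pderiv a23) t * (z t)\<^sup>2)
     + z t * (poly (pderiv a31) t + poly (pderiv a32) t * (y t)\<^sup>2 + poly (pderiv a33) t * (z t)\<^sup>2)
     + poly (pderiv c) t * (y t * z t) = 0"
    using nodal_affine[OF two S c, of z a21 a22 y a23 a31 a32 a33 a11 a12 a13] yz
    unfolding cubic_critical_def add_eq_0_iff neg by auto
  thus ?thesis using yz[of t] by (intro exI[of _ t] exI[of _ 1] exI[of _ "y t"] exI[of _ "z t"]) (simp add: cubic_form_def)
qed

text \<open>One of the three coordinates is nonzero at the critical points for infinitely many
  \<open>t\<close>. Permuting variables, rows and columns simultaneously moves it into the first
  place, where \<open>nodal_chart\<close> applies.\<close>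

lemma nodal:
  fixes a11 a12 a13 a21 a22 a23 a31 a32 a33 c :: "'a::field poly"
  assumes two: "(2::'a) = 0" and S: "infinite S" and c: "c \<noteq> 0"
    and sing: "\<And>t. t \<in> S \<Longrightarrow> \<exists>x y z. (x, y, z) \<noteq> (0, 0, 0) \<and> cubic_critical (poly a11 t) (poly a12 t) (poly a13 t) (poly a21 t)
      (poly a22 t) (poly a23 t) (poly a31 t) (poly a32 t) (poly a33 t) (poly c t) x y z"
  shows "\<exists>t x y z. (x, y, z) \<noteq> (0, 0, 0) \<and> cubic_critical (poly a11 t) (poly a12 t) (poly a13 t) (poly a21 t)
      (poly a22 t) (poly a23 t) (poly a31 t) (poly a32 t) (poly a33 t) (poly c t) x y z \<and>
      cubic_form (poly (pderiv a11) t) (poly (pderiv a12) t) (poly (pderiv a13) t) (poly (pderiv a21) t)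
      (poly (pderiv a22) t) (poly (pderiv a23) t) (poly (pderiv a31) t) (poly (pderiv a32) t)
      (poly (pderiv a33) t) (poly (pderiv c) t) x y z = 0" (is "\<exists>t x y z. _ \<and> ?Q t x y z \<and> ?D t x y z = 0")
proof -
  define X where "X = {t\<in>S. \<exists>x y z. x \<noteq> 0 \<and> ?Q t x y z}"
  define Y where "Y = {t\<in>S. \<exists>x y z. y \<noteq> 0 \<and> ?Q t x y z}"
  define Z where "Z = {t\<in>S. \<exists>x y z. z \<noteq> 0 \<and> ?Q t x y z}"
  have "S \<subseteq> X \<union> Y \<union> Z"
  proof
    fix t assume t: "t \<in> S"
    from sing[OF t] obtain x y z where "(x, y, z) \<noteq> (0, 0, 0)" "?Q t x y z" by blast
    thus "t \<in> X \<union> Y \<union> Z" using t unfolding X_def Y_def Z_def by blast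
  qed
  hence "infinite X \<or> infinite Y \<or> infinite Z" using S finite_subset by blast
  thus ?thesis
  proof (elim disjE)
    assume "infinite X"
    from nodal_chart[OF two this c, of a11 a12 a13 a21 a22 a23 a31 a32 a33] show ?thesis
      unfolding X_def by blast
  next
    have sw: "cubic_critical a22 a21 a23 a12 a11 a13 a32 a31 a33 c y x z = cubic_critical a11 a12 a13 a21 a22 a23 a31 a32 a33 c x y z"
      "cubic_form a22 a21 a23 a12 a11 a13 a32 a31 a33 c y x z = cubic_form a11 a12 a13 a21 a22 a23 a31 a32 a33 c x y z"
      for a11 a12 a13 a21 a22 a23 a31 a32 a33 c x y z :: 'a
      by (auto simp: cubic_critical_def cubic_form_def algebra_simps)
    assume inf: "infinite Y"
    have "\<exists>t x y z. x \<noteq> 0 \<and> cubic_critical (poly a22 t) (poly a21 t) (poly a23 t) (poly a12 t) (poly a11 t) (poly a13 t) (poly a32 t) (poly a31 t) (poly a33 t) (poly c t) x y z \<and>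
        cubic_form (poly (pderiv a22) t) (poly (pderiv a21) t) (poly (pderiv a23) t) (poly (pderiv a12) t) (poly (pderiv a11) t) (poly (pderiv a13) t) (poly (pderiv a32) t) (poly (pderiv a31) t) (poly (pderiv a33) t) (poly (pderiv c) t) x y z = 0"
    proof (rule nodal_chart[OF two inf c])
      fix t assume "t \<in> Y"
      then obtain x y z where "y \<noteq> 0" "?Q t x y z" unfolding Y_def by blast
      moreover from this(2) have "cubic_critical (poly a22 t) (poly a21 t) (poly a23 t) (poly a12 t) (poly a11 t) (poly a13 t) (poly a32 t) (poly a31 t) (poly a33 t) (poly c t) y x z" by (subst sw)
      ultimately show "\<exists>x y z. x \<noteq> 0 \<and> cubic_critical (poly a22 t) (poly a21 t) (poly a23 t) (poly a12 t) (poly a11 t) (poly a13 t) (poly a32 t) (poly a31 t) (poly a33 t) (poly c t) x y z" by blast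
    qed
    then obtain t y x z where *: "y \<noteq> 0" "cubic_critical (poly a22 t) (poly a21 t) (poly a23 t) (poly a12 t) (poly a11 t) (poly a13 t) (poly a32 t) (poly a31 t) (poly a33 t) (poly c t) y x z"
        "cubic_form (poly (pderiv a22) t) (poly (pderiv a21) t) (poly (pderiv a23) t) (poly (pderiv a12) t) (poly (pderiv a11) t) (poly (pderiv a13) t) (poly (pderiv a32) t) (poly (pderiv a31) t) (poly (pderiv a33) t) (poly (pderiv c) t) y x z = 0" by blast
    from *(2) have "?Q t x y z" by (subst (asm) sw)
    moreover from *(3) have "?D t x y z = 0" by (subst (asm) sw)
    ultimately show ?thesis using *(1) by blast
  next
    have sw: "cubic_critical a33 a32 a31 a23 a22 a21 a13 a12 a11 c z y x = cubic_critical a11 a12 a13 a21 a22 a23 a31 a32 a33 c x y z"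
      "cubic_form a33 a32 a31 a23 a22 a21 a13 a12 a11 c z y x = cubic_form a11 a12 a13 a21 a22 a23 a31 a32 a33 c x y z"
      for a11 a12 a13 a21 a22 a23 a31 a32 a33 c x y z :: 'a
      by (auto simp: cubic_critical_def cubic_form_def algebra_simps)
    assume inf: "infinite Z"
    have "\<exists>t x y z. x \<noteq> 0 \<and> cubic_critical (poly a33 t) (poly a32 t) (poly a31 t) (poly a23 t) (poly a22 t) (poly a21 t) (poly a13 t) (poly a12 t) (poly a11 t) (poly c t) x y z \<and>
        cubic_form (poly (pderiv a33) t) (poly (pderiv a32) t) (poly (pderiv a31) t) (poly (pderiv a23) t) (poly (pderiv a22) t) (poly (pderiv a21) t) (poly (pderiv a13) t) (poly (pderiv a12) t) (poly (pderiv a11) t) (poly (pderiv c) t) x y z = 0"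
    proof (rule nodal_chart[OF two inf c])
      fix t assume "t \<in> Z"
      then obtain x y z where "z \<noteq> 0" "?Q t x y z" unfolding Z_def by blast
      moreover from this(2) have "cubic_critical (poly a33 t) (poly a32 t) (poly a31 t) (poly a23 t) (poly a22 t) (poly a21 t) (poly a13 t) (poly a12 t) (poly a11 t) (poly c t) z y x" by (subst sw)
      ultimately show "\<exists>x y z. x \<noteq> 0 \<and> cubic_critical (poly a33 t) (poly a32 t) (poly a31 t) (poly a23 t) (poly a22 t) (poly a21 t) (poly a13 t) (poly a12 t) (poly a11 t) (poly c t) x y z" by blast
    qed
    then obtain t z y x where *: "z \<noteq> 0" "cubic_critical (poly a33 t) (poly a32 t) (poly a31 t) (poly a23 t) (poly a22 t) (poly a21 t) (poly a13 t) (poly a12 t) (poly a11 t) (poly c t) z y x"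
        "cubic_form (poly (pderiv a33) t) (poly (pderiv a32) t) (poly (pderiv a31) t) (poly (pderiv a23) t) (poly (pderiv a22) t) (poly (pderiv a21) t) (poly (pderiv a13) t) (poly (pderiv a12) t) (poly (pderiv a11) t) (poly (pderiv c) t) z y x = 0" by blast
    from *(2) have "?Q t x y z" by (subst (asm) sw)
    moreover from *(3) have "?D t x y z = 0" by (subst (asm) sw)
    ultimately show ?thesis using *(1) by blast
  qed
qed

section \<open>Cuspidal fibers\<close>

text \<open>Division is avoided by using cross products of rows: a nonzero one annihilates its two
  rows, and also the third because the determinant is 0. If all cross products vanish, the rows are
  proportional to any nonzero row.\<close>

lemma det_eq_0_imp_kernel_vector:
  fixes a11 a12 a13 a21 a22 a23 a31 a32 a33 :: "'a::idom"
  assumes det: "a11 * (a22 * a33 - a23 * a32) - a12 * (a21 * a33 - a23 * a31) + a13 * (a21 * a32 - a22 * a31) = 0"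
  shows "\<exists>v1 v2 v3. (v1, v2, v3) \<noteq> (0, 0, 0) \<and> a11 * v1 + a12 * v2 + a13 * v3 = 0
    \<and> a21 * v1 + a22 * v2 + a23 * v3 = 0 \<and> a31 * v1 + a32 * v2 + a33 * v3 = 0"
proof -
  consider (c12) "(a12 * a23 - a13 * a22, a13 * a21 - a11 * a23, a11 * a22 - a12 * a21) \<noteq> (0,0,0)"
    | (c13) "(a12 * a33 - a13 * a32, a13 * a31 - a11 * a33, a11 * a32 - a12 * a31) \<noteq> (0,0,0)"
    | (c23) "(a22 * a33 - a23 * a32, a23 * a31 - a21 * a33, a21 * a32 - a22 * a31) \<noteq> (0,0,0)"
    | (r1) "a12 * a23 = a13 * a22" "a13 * a21 = a11 * a23" "a11 * a22 = a12 * a21"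
       "a12 * a33 = a13 * a32" "a13 * a31 = a11 * a33" "a11 * a32 = a12 * a31"
       "a22 * a33 = a23 * a32" "a23 * a31 = a21 * a33" "a21 * a32 = a22 * a31"
    by (simp only: prod.inject right_minus_eq) blast
  thus ?thesis
  proof cases
    case c12
    have "a11 * (a12 * a23 - a13 * a22) + a12 * (a13 * a21 - a11 * a23) + a13 * (a11 * a22 - a12 * a21) = 0"
      "a21 * (a12 * a23 - a13 * a22) + a22 * (a13 * a21 - a11 * a23) + a23 * (a11 * a22 - a12 * a21) = 0"
      "a31 * (a12 * a23 - a13 * a22) + a32 * (a13 * a21 - a11 * a23) + a33 * (a11 * a22 - a12 * a21) = (a11 * (a22 * a33 - a23 * a32) - a12 * (a21 * a33 - a23 * a31) + a13 * (a21 * a32 - a22 * a31))"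
      by (simp_all add: algebra_simps)
    note this[unfolded det minus_zero]
    with c12 show ?thesis by blast
  next
    case c13
    have "a11 * (a12 * a33 - a13 * a32) + a12 * (a13 * a31 - a11 * a33) + a13 * (a11 * a32 - a12 * a31) = 0"
      "a21 * (a12 * a33 - a13 * a32) + a22 * (a13 * a31 - a11 * a33) + a23 * (a11 * a32 - a12 * a31) = -(a11 * (a22 * a33 - a23 * a32) - a12 * (a21 * a33 - a23 * a31) + a13 * (a21 * a32 - a22 * a31))"
      "a31 * (a12 * a33 - a13 * a32) + a32 * (a13 * a31 - a11 * a33) + a33 * (a11 * a32 - a12 * a31) = 0"
      by (simp_all add: algebra_simps)
    note this[unfolded det minus_zero]
    with c13 show ?thesis by blast
  next
    case c23
    have "a11 * (a22 * a33 - a23 * a32) + a12 * (a23 * a31 - a21 * a33) + a13 * (a21 * a32 - a22 * a31) = (a11 * (a22 * a33 - a23 * a32) - a12 * (a21 * a33 - a23 * a31) + a13 * (a21 * a32 - a22 * a31))"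
      "a21 * (a22 * a33 - a23 * a32) + a22 * (a23 * a31 - a21 * a33) + a23 * (a21 * a32 - a22 * a31) = 0"
      "a31 * (a22 * a33 - a23 * a32) + a32 * (a23 * a31 - a21 * a33) + a33 * (a21 * a32 - a22 * a31) = 0"
      by (simp_all add: algebra_simps)
    note this[unfolded det minus_zero]
    with c23 show ?thesis by blast
  next
    case r1
    \<comment> \<open>\<open>(p, q, r)\<close> is a nonzero row to which all others are
      proportional; \<open>(q, -p, 0)\<close> annihilates it, and so does \<open>(1, 0, 0)\<close>
      when \<open>p = q = 0\<close>.\<close>
    have row: ?thesis if "(p, q, r) \<noteq> (0,0,0)"
      "a11 * q = a12 * p" "a11 * r = a13 * p" "a12 * r = a13 * q"
      "a21 * q = a22 * p" "a21 * r = a23 * p" "a22 * r = a23 * q"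
      "a31 * q = a32 * p" "a31 * r = a33 * p" "a32 * r = a33 * q" for p q r
    proof (cases "p = 0 \<and> q = 0")
      case True
      hence "r \<noteq> 0" "a11 = 0" "a21 = 0" "a31 = 0" using that by auto
      thus ?thesis by (intro exI[of _ 1] exI[of _ 0]) auto
    next
      case False
      thus ?thesis using that by (intro exI[of _ q] exI[of _ "-p"] exI[of _ 0]) auto
    qed
    show ?thesis
    proof (cases "(a11, a12, a13) = (0,0,0)")
      case False
      show ?thesis by (rule row[OF False]) (use r1 in \<open>simp_all add: ac_simps\<close>)
    next
      case t1: True
      show ?thesis
      proof (cases "(a21, a22, a23) = (0,0,0)")
        case False
        show ?thesis by (rule row[OF False]) (use r1 t1 in \<open>simp_all add: ac_simps\<close>)
      next
        case t2: True
        show ?thesis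
        proof (cases "(a31, a32, a33) = (0,0,0)")
          case False
          show ?thesis by (rule row[OF False]) (use r1 t1 t2 in \<open>simp_all add: ac_simps\<close>)
        next
          case True
          thus ?thesis using t1 t2 by (intro exI[of _ 1]) auto
        qed
      qed
    qed
  qed
qed

text \<open>With \<open>m\<close> and \<open>n\<close> as nominal degrees, this is the value of a
  product at infinity. \<open>coeff_mult_subtop\<close> is the next term of the expansion in
  \<open>1/t\<close>.\<close>

lemma coeff_mult_top:
  fixes p q :: "'a::comm_semiring_1 poly"
  assumes "degree p \<le> m" "degree q \<le> n"
  shows "coeff (p * q) (m + n) = coeff p m * coeff q n"
proof -
  have "coeff (p * q) (m + n) = (\<Sum>i\<le>m+n. coeff p i * coeff q (m + n - i))" by (rule coeff_mult)
  also have "\<dots> = (\<Sum>i\<in>{m}. coeff p i * coeff q (m + n - i))"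
  proof (rule sum.mono_neutral_right)
    show "\<forall>i\<in>{..m+n} - {m}. coeff p i * coeff q (m + n - i) = 0"
    proof
      fix i assume "i \<in> {..m+n} - {m}"
      hence "i > m \<or> m + n - i > n" by auto
      thus "coeff p i * coeff q (m + n - i) = 0" using assms by (auto simp: coeff_eq_0)
    qed
  qed auto
  finally show ?thesis by simp
qed

lemma coeff_mult_subtop:
  fixes p q :: "'a::comm_semiring_1 poly"
  assumes "degree p \<le> Suc m" "degree q \<le> Suc n"
  shows "coeff (p * q) (Suc (m + n)) = coeff p (Suc m) * coeff q n + coeff p m * coeff q (Suc n)"
proof -
  have "coeff (p * q) (Suc (m + n)) = (\<Sum>i\<le>Suc(m+n). coeff p i * coeff q (Suc (m + n) - i))" by (rule coeff_mult)
  also have "\<dots> = (\<Sum>i\<in>{m, Suc m}. coeff p i * coeff q (Suc (m + n) - i))"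
  proof (rule sum.mono_neutral_right)
    show "\<forall>i\<in>{..Suc(m+n)} - {m, Suc m}. coeff p i * coeff q (Suc(m + n) - i) = 0"
    proof
      fix i assume "i \<in> {..Suc(m+n)} - {m, Suc m}"
      hence "i > Suc m \<or> Suc (m + n) - i > Suc n" by auto
      thus "coeff p i * coeff q (Suc (m + n) - i) = 0" using assms by (auto simp: coeff_eq_0)
    qed
  qed auto
  finally show ?thesis by (simp add: add.commute Suc_diff_le)
qed

lemma square_root_exists: "\<exists>y. y\<^sup>2 = (x :: 'a::alg_closed_field)"
  using nth_root_exists[of 2 x] by auto

text \<open>The second alternative is the fiber over \<open>t = \<infinity>\<close>, in the coordinate \<open>1/t\<close>.\<close>

lemma cuspidal:
  fixes a11 a12 a13 a21 a22 a23 a31 a32 a33 :: "'a::alg_closed_field poly"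
  assumes two: "(2::'a) = 0"
    and deg: "degree a11 \<le> 4" "degree a12 \<le> 2" "degree a13 \<le> 2"
      "degree a21 \<le> 3" "degree a22 \<le> 1" "degree a23 \<le> 1"
      "degree a31 \<le> 3" "degree a32 \<le> 1" "degree a33 \<le> 1"
    and det: "a11 * (a22 * a33 - a23 * a32) - a12 * (a21 * a33 - a23 * a31) + a13 * (a21 * a32 - a22 * a31) = 0"
  shows "(\<exists>t x y z. (x, y, z) \<noteq> (0, 0, 0) \<and> cubic_critical (poly a11 t) (poly a12 t) (poly a13 t) (poly a21 t)
      (poly a22 t) (poly a23 t) (poly a31 t) (poly a32 t) (poly a33 t) 0 x y z \<and>
      cubic_form (poly (pderiv a11) t) (poly (pderiv a12) t) (poly (pderiv a13) t) (poly (pderiv a21) t)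
      (poly (pderiv a22) t) (poly (pderiv a23) t) (poly (pderiv a31) t) (poly (pderiv a32) t)
      (poly (pderiv a33) t) 0 x y z = 0) \<or>
    (\<exists>x y z. (x, y, z) \<noteq> (0, 0, 0) \<and> cubic_critical (coeff a11 4) (coeff a12 2) (coeff a13 2) (coeff a21 3)
      (coeff a22 1) (coeff a23 1) (coeff a31 3) (coeff a32 1) (coeff a33 1) 0 x y z \<and>
      cubic_form (coeff a11 3) (coeff a12 1) (coeff a13 1) (coeff a21 2)
      (coeff a22 0) (coeff a23 0) (coeff a31 2) (coeff a32 0) (coeff a33 0) 0 x y z = 0)"
proof -
  \<comment> \<open>the first coordinate has weight 2, as the first column of \<open>A\<close> has degree 2 more than the others\<close>
  define K where "K e v1 v2 v3 \<longleftrightarrow> (v1, v2, v3) \<noteq> (0, 0, 0) \<and> a11 * v1 + a12 * v2 + a13 * v3 = 0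
    \<and> a21 * v1 + a22 * v2 + a23 * v3 = 0 \<and> a31 * v1 + a32 * v2 + a33 * v3 = 0
    \<and> degree (monom 1 2 * v1) \<le> e \<and> degree v2 \<le> e \<and> degree v3 \<le> e" for e v1 v2 v3
  have "\<exists>e v1 v2 v3. K e v1 v2 v3"
  proof -
    obtain v1 v2 v3 where "(v1, v2, v3) \<noteq> (0, 0, 0)" "a11 * v1 + a12 * v2 + a13 * v3 = 0"
      "a21 * v1 + a22 * v2 + a23 * v3 = 0" "a31 * v1 + a32 * v2 + a33 * v3 = 0"
      using det_eq_0_imp_kernel_vector[OF det] by blast
    hence "K (max (degree (monom 1 2 * v1)) (max (degree v2) (degree v3))) v1 v2 v3"
      unfolding K_def by (simp add: le_max_iff_disj)
    thus ?thesis by blast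
  qed
  \<comment> \<open>A kernel vector of least weighted degree vanishes nowhere on the projective
    line: a common zero at a finite \<open>t\<close> could be divided out (\<open>prim\<close>), and
    one at infinity would lower the degree bound (\<open>top_nz\<close>).\<close>
  then obtain e where "\<exists>v1 v2 v3. K e v1 v2 v3" and e_min: "\<And>e'. e' < e \<Longrightarrow> \<not> (\<exists>v1 v2 v3. K e' v1 v2 v3)"
    unfolding exists_least_iff[of "\<lambda>e. \<exists>v1 v2 v3. K e v1 v2 v3"] by (elim exE conjE) metis
  then obtain v1 v2 v3 where v: "K e v1 v2 v3" by blast
  define V1 where "V1 = monom 1 2 * v1"
  have nz: "(v1, v2, v3) \<noteq> (0, 0, 0)" and
    ker: "a11 * v1 + a12 * v2 + a13 * v3 = 0" "a21 * v1 + a22 * v2 + a23 * v3 = 0" "a31 * v1 + a32 * v2 + a33 * v3 = 0" and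
    dv: "degree V1 \<le> e" "degree v2 \<le> e" "degree v3 \<le> e"
    using v unfolding K_def V1_def by auto
  have deg_V1: "degree V1 = degree v1 + 2" if "v1 \<noteq> 0"
    using that unfolding V1_def by (simp add: degree_mult_eq degree_monom_eq)
  have V1_0: "V1 = 0 \<longleftrightarrow> v1 = 0" unfolding V1_def by (simp add: monom_eq_0_iff)
  define w1 w2 w3 where "w1 = pderiv a11 * v1 + pderiv a12 * v2 + pderiv a13 * v3"
    and "w2 = pderiv a21 * v1 + pderiv a22 * v2 + pderiv a23 * v3"
    and "w3 = pderiv a31 * v1 + pderiv a32 * v2 + pderiv a33 * v3"
  define h where "h = v1 * w1\<^sup>2 + v2 * w2\<^sup>2 + v3 * w3\<^sup>2"
  have prim: "(poly v1 t, poly v2 t, poly v3 t) \<noteq> (0, 0, 0)" for t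
  proof
    assume "(poly v1 t, poly v2 t, poly v3 t) = (0, 0, 0)"
    then obtain u1 u2 u3 where u: "v1 = [:-t, 1:] * u1" "v2 = [:-t, 1:] * u2" "v3 = [:-t, 1:] * u3"
      unfolding prod.inject poly_eq_0_iff_dvd dvd_def by blast
    have nzt: "[:-t, 1:] \<noteq> 0" by simp
    have unz: "(u1, u2, u3) \<noteq> (0, 0, 0)" using nz u by auto
    have "q * b1 + r * b2 + s * b3 = 0"
      if "q * ([:-t, 1:] * b1) + r * ([:-t, 1:] * b2) + s * ([:-t, 1:] * b3) = 0" for q r s b1 b2 b3 :: "'a poly"
    proof -
      have "[:-t, 1:] * (q * b1 + r * b2 + s * b3) = 0"
        using that by (simp only: distrib_left mult.left_commute)
      thus ?thesis using nzt by (simp only: mult_eq_0_iff) blast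
    qed
    note uker = this[OF ker(1)[unfolded u]] this[OF ker(2)[unfolded u]] this[OF ker(3)[unfolded u]]
    have lin: "p = 0 \<or> degree ([:-t, 1:] * p) = Suc (degree p)" for p :: "'a poly"
      using degree_mult_eq[OF nzt, of p] by auto
    have d1: "degree (monom 1 2 * u1) = 0 \<or> Suc (degree (monom 1 2 * u1)) \<le> e"
      using lin[of "monom 1 2 * u1"] dv(1) unfolding V1_def u by (auto simp: mult.left_commute)
    have d2: "u2 = 0 \<or> Suc (degree u2) \<le> e" and d3: "u3 = 0 \<or> Suc (degree u3) \<le> e"
      using lin[of u2] lin[of u3] dv unfolding u by auto
    \<comment> \<open>\<open>e - 1\<close> is a truncated subtraction, so \<open>e = 0\<close> has
      to be excluded before the smaller vector contradicts minimality.\<close>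
    have "e > 0"
    proof (rule ccontr)
      assume "\<not> e > 0"
      hence "e = 0" by simp
      hence "u2 = 0" "u3 = 0" "v1 = 0" using d2 d3 dv(1) deg_V1 by auto
      moreover from u(1) \<open>v1 = 0\<close> nzt have "u1 = 0" by (metis mult_eq_0_iff)
      ultimately show False using unz by blast
    qed
    have "degree (monom 1 2 * u1) \<le> e - 1" using d1 by linarith
    moreover have "degree u2 \<le> e - 1" "degree u3 \<le> e - 1" using d2 d3 by auto
    ultimately have "K (e - 1) u1 u2 u3" unfolding K_def using unz uker by blast
    thus False using e_min[of "e - 1"] \<open>e > 0\<close> by auto
  qed
  show ?thesis
  proof (cases "\<exists>t. poly h t = 0")
    case True
    then obtain t where t: "poly h t = 0" by blast
    obtain x y z where xyz: "x\<^sup>2 = poly v1 t" "y\<^sup>2 = poly v2 t" "z\<^sup>2 = poly v3 t"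
      using square_root_exists by metis
    have "(x, y, z) \<noteq> (0, 0, 0)" using prim[of t] xyz by auto
    moreover have "cubic_critical (poly a11 t) (poly a12 t) (poly a13 t) (poly a21 t)
      (poly a22 t) (poly a23 t) (poly a31 t) (poly a32 t) (poly a33 t) 0 x y z"
      using ker[THEN arg_cong[of _ _ "\<lambda>p. poly p t"]] unfolding cubic_critical_def xyz by simp
    moreover have "(x * poly w1 t + y * poly w2 t + z * poly w3 t)\<^sup>2 = poly h t"
      unfolding h_def by (simp add: square_add_char2[OF two] power_mult_distrib xyz)
    hence "x * poly w1 t + y * poly w2 t + z * poly w3 t = 0" using t by simp
    hence "cubic_form (poly (pderiv a11) t) (poly (pderiv a12) t) (poly (pderiv a13) t) (poly (pderiv a21) t)
      (poly (pderiv a22) t) (poly (pderiv a23) t) (poly (pderiv a31) t) (poly (pderiv a32) t)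
      (poly (pderiv a33) t) 0 x y z = 0"
      unfolding cubic_form_def xyz w1_def w2_def w3_def by simp
    ultimately show ?thesis by blast
  next
    case False
    \<comment> \<open>Without zeros \<open>h\<close> is constant. Its nominal degree is
      \<open>3 * n + 1\<close> with \<open>e = Suc n\<close>, so the zero must lie at
      infinity.\<close>
    have "degree h = 0" using False alg_closed_imp_poly_has_root[of h] by (cases "degree h") auto
    \<comment> \<open>For \<open>e = 0\<close> the kernel vector would be constant with
      \<open>v1 = 0\<close>. Then \<open>w1\<close>, \<open>w2\<close>, \<open>w3\<close> would be
      the derivatives of the kernel equations, and \<open>h\<close> would be 0.\<close>
    have e0: "e > 0"
    proof (rule ccontr)
      assume "\<not> e > 0"
      hence e: "e = 0" by simp
      hence v1: "v1 = 0" and "degree v2 = 0" "degree v3 = 0" using dv deg_V1 by auto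
      then obtain p q where "v2 = [:p:]" "v3 = [:q:]" by (metis degree_eq_zeroE)
      hence "w1 = pderiv (a11 * v1 + a12 * v2 + a13 * v3)" "w2 = pderiv (a21 * v1 + a22 * v2 + a23 * v3)"
        "w3 = pderiv (a31 * v1 + a32 * v2 + a33 * v3)"
        unfolding w1_def w2_def w3_def v1 by (simp_all add: pderiv_add pderiv_mult pderiv_smult)
      hence "h = 0" unfolding h_def ker by simp
      thus False using False by simp
    qed
    then obtain n where n: "e = Suc n" by (cases e) auto
    have deg_drop: "degree p \<le> m" if "degree p \<le> Suc m" "coeff p (Suc m) = 0" for p :: "'a poly" and m
      using that by (metis le_Suc_eq leading_coeff_0_iff degree_0 le0)
    have top_nz: "(coeff V1 e, coeff v2 e, coeff v3 e) \<noteq> (0, 0, 0)"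
    proof
      assume "(coeff V1 e, coeff v2 e, coeff v3 e) = (0, 0, 0)"
      hence "coeff V1 (Suc n) = 0" "coeff v2 (Suc n) = 0" "coeff v3 (Suc n) = 0" using n by auto
      hence "degree V1 \<le> n \<and> degree v2 \<le> n \<and> degree v3 \<le> n"
        using dv deg_drop unfolding n by blast
      hence "K n v1 v2 v3" using nz ker unfolding K_def V1_def by auto
      thus False using e_min[of n] n by auto
    qed
    define M where "M = (monom 1 2 :: 'a poly)"
    \<comment> \<open>\<open>(X, Y, Z)\<close> is the kernel vector at infinity. The matrix of
      next-to-leading coefficients, which is the derivative in \<open>1/t\<close> at infinity, sends
      it to \<open>\<omega>1\<close> and the values of \<open>\<omega>\<close> for the other two
      rows.\<close>
    define X Y Z where "X = coeff V1 e" and "Y = coeff v2 e" and "Z = coeff v3 e"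
    define \<omega> where "\<omega> p q r = coeff p 2 * X + coeff q 0 * Y + coeff r 0 * Z" for p q r :: "'a poly"
    define \<omega>1 where "\<omega>1 = coeff a11 3 * X + coeff a12 1 * Y + coeff a13 1 * Z"
    have cM: "coeff (M * p) (Suc (Suc k)) = coeff p k" "coeff (M * p) 0 = 0" "coeff (M * p) (Suc 0) = 0" for p k
      by (simp_all add: M_def coeff_monom_mult)
    have cM2: "coeff (M * p) 2 = coeff p 0" for p using cM(1)[of p 0] by (simp add: numeral_2_eq_2)
    have degM: "degree p + 2 = degree (M * p)" if "p \<noteq> 0" for p
      using that unfolding M_def by (simp add: degree_mult_eq degree_monom_eq)
    have degM': "degree (M * p) \<le> k + 2" if "degree p \<le> k" for p k
      using degM[of p] that by (cases "p = 0") auto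
    have degM'': "degree p \<le> k" if "degree (M * p) \<le> k + 2" for p k
      using degM[of p] that by (cases "p = 0") auto
    \<comment> \<open>After multiplication by \<open>M\<close>, which is \<open>t^2\<close>, all
      coefficients of the equation have the same nominal degree, 4 here and 3 in the other two rows,
      so leading terms can be compared.\<close>
    have eq1: "a11 * V1 + (M * a12) * v2 + (M * a13) * v3 = 0"
      using arg_cong[OF ker(1), of "\<lambda>p. M * p"] unfolding V1_def M_def by (simp add: algebra_simps)
    have L1: "coeff a11 4 * X + coeff a12 2 * Y + coeff a13 2 * Z = 0"
      using arg_cong[OF eq1, of "\<lambda>p. coeff p (4 + e)"]
      using coeff_mult_top[OF deg(1) dv(1)] coeff_mult_top[OF degM'[OF deg(2)] dv(2)] coeff_mult_top[OF degM'[OF deg(3)] dv(3)]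
      by (simp add: X_def Y_def Z_def cM numeral_eq_Suc)
    have char2_simps: "(3::'a) = 1" "(4::'a) = 0"
    proof -
      have "(3::'a) = 2 + 1" "(4::'a) = 2 + 2" by simp_all
      thus "(3::'a) = 1" "(4::'a) = 0" using two by simp_all
    qed
    have neg: "- a = a" for a :: 'a using two by (metis add_eq_0_iff mult_2 mult_zero_left)
    have dpd: "degree (pderiv p) \<le> k" if "degree p \<le> Suc k" for p :: "'a poly" and k
      by (rule degree_le) (use that in \<open>auto simp: coeff_pderiv coeff_eq_0\<close>)
    \<comment> \<open>The derivatives of \<open>t^2\<close> and \<open>t^4\<close> are 0 in
      characteristic 2, so in \<open>d0\<close> and \<open>d2\<close> the degree bound drops by 2
      instead of 1.\<close>
    have d0: "degree (pderiv p) \<le> 0" if "degree p \<le> 2" for p :: "'a poly"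
      by (rule deg_drop) (use dpd[of p 1] that two in \<open>auto simp: coeff_pderiv numeral_2_eq_2\<close>)
    have d2: "degree (pderiv p) \<le> 2" if "degree p \<le> 4" for p :: "'a poly"
      by (rule deg_drop) (use dpd[of p 3] that char2_simps two in \<open>auto simp: coeff_pderiv eval_nat_numeral\<close>)
    have Mw1: "M * w1 = pderiv a11 * V1 + (M * pderiv a12) * v2 + (M * pderiv a13) * v3"
      unfolding w1_def V1_def M_def by (simp add: algebra_simps)
    note dw1 = d2[OF deg(1)] degM'[OF d0[OF deg(2)]] degM'[OF d0[OF deg(3)]]
    have "degree (M * w1) \<le> e + 2"
      unfolding Mw1 using dw1 dv
      by (intro degree_add_le order.trans[OF degree_mult_le]) auto
    hence deg_w1: "degree w1 \<le> e" by (rule degM'')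
    have "coeff (M * w1) (2 + e) = \<omega>1"
      unfolding Mw1 using coeff_mult_top[OF dw1(1) dv(1)] coeff_mult_top[OF _ dv(2), of "M * pderiv a12" 2]
        coeff_mult_top[OF _ dv(3), of "M * pderiv a13" 2] dw1 cM(1)[of _ 0]
      by (simp add: numeral_2_eq_2[symmetric] \<omega>1_def X_def Y_def Z_def coeff_pderiv char2_simps)
    hence w1: "coeff w1 e = \<omega>1" by (simp add: cM)
    \<comment> \<open>In the second and third row the expected leading coefficient of the
      differentiated row repeats the kernel equation at infinity, because 3 = 1, and so is 0. The
      next one equals \<open>\<omega>\<close> by the subleading kernel equation
      \<open>S\<close>.\<close>
    have row: "coeff p 3 * X + coeff q 1 * Y + coeff r 1 * Z = 0"
      "degree (pderiv p * v1 + pderiv q * v2 + pderiv r * v3) \<le> n"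
      "coeff (pderiv p * v1 + pderiv q * v2 + pderiv r * v3) n = \<omega> p q r"
      if dp: "degree p \<le> 3" "degree q \<le> 1" "degree r \<le> 1" and kr: "p * v1 + q * v2 + r * v3 = 0" for p q r
    proof -
      define w where "w = pderiv p * v1 + pderiv q * v2 + pderiv r * v3"
      have eq: "p * V1 + (M * q) * v2 + (M * r) * v3 = 0"
        using arg_cong[OF kr, of "\<lambda>p. M * p"] unfolding V1_def M_def by (simp add: algebra_simps)
      have dq: "degree (M * q) \<le> 3" "degree (M * r) \<le> 3"
        using degM'[OF dp(2)] degM'[OF dp(3)] by auto
      show L: "coeff p 3 * X + coeff q 1 * Y + coeff r 1 * Z = 0"
        using arg_cong[OF eq, of "\<lambda>p. coeff p (3 + e)"] coeff_mult_top[OF dp(1) dv(1)]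
          coeff_mult_top[OF dq(1) dv(2)] coeff_mult_top[OF dq(2) dv(3)]
        by (simp add: X_def Y_def Z_def cM numeral_3_eq_3)
      have S: "coeff p 3 * coeff V1 n + coeff p 2 * X + (coeff q 1 * coeff v2 n + coeff q 0 * Y)
          + (coeff r 1 * coeff v3 n + coeff r 0 * Z) = 0"
        using arg_cong[OF eq, of "\<lambda>p. coeff p (Suc (2 + n))"]
          coeff_mult_subtop[of p 2 V1 n] coeff_mult_subtop[of "M * q" 2 v2 n] coeff_mult_subtop[of "M * r" 2 v3 n] dp(1) dq dv
        by (simp add: X_def Y_def Z_def cM n numeral_3_eq_3 numeral_2_eq_2)
      have Mw: "M * w = pderiv p * V1 + (M * pderiv q) * v2 + (M * pderiv r) * v3"
        unfolding w_def V1_def M_def by (simp add: algebra_simps)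
      have dp': "degree (pderiv p) \<le> 2" using dpd[of p 2] dp(1) by simp
      have dq': "degree (M * pderiv q) \<le> 2" "degree (M * pderiv r) \<le> 2"
        using degM'[OF d0[of q]] degM'[OF d0[of r]] dp by auto
      have "degree (M * w) \<le> Suc (n + 2)"
        unfolding Mw using dp' dq' dv n
        by (intro degree_add_le order.trans[OF degree_mult_le]) auto
      moreover have "coeff (M * w) (Suc (n + 2)) = 0"
        using L coeff_mult_top[OF dp' dv(1)] coeff_mult_top[OF dq'(1) dv(2)] coeff_mult_top[OF dq'(2) dv(3)]
        unfolding Mw by (simp add: X_def Y_def Z_def cM n numeral_2_eq_2 coeff_pderiv char2_simps numeral_3_eq_3)
      ultimately have "degree (M * w) \<le> n + 2" by (rule deg_drop)
      thus "degree (pderiv p * v1 + pderiv q * v2 + pderiv r * v3) \<le> n"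
        unfolding w_def by (rule degM'')
      have "coeff (M * w) (Suc (1 + n)) = coeff p 3 * coeff V1 n + coeff q 1 * coeff v2 n + coeff r 1 * coeff v3 n"
        using coeff_mult_subtop[of "pderiv p" 1 V1 n] coeff_mult_subtop[of "M * pderiv q" 1 v2 n]
          coeff_mult_subtop[of "M * pderiv r" 1 v3 n] dp' dq' dv
        unfolding Mw by (simp add: two char2_simps cM cM2 n coeff_pderiv numeral_2_eq_2[symmetric] numeral_3_eq_3[symmetric])
      also have "\<dots> = - \<omega> p q r" using S unfolding \<omega>_def by algebra
      finally show "coeff (pderiv p * v1 + pderiv q * v2 + pderiv r * v3) n = \<omega> p q r"
        using neg by (simp add: cM w_def)
    qed
    note row2 = row[OF deg(4-6) ker(2), folded w2_def]
    note row3 = row[OF deg(7-9) ker(3), folded w3_def]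
    have three_n: "n + (n + n) = 3 * n" by simp
    have csq: "coeff (p * q\<^sup>2) (k + (m + m)) = coeff p k * (coeff q m)\<^sup>2"
      if "degree p \<le> k" "degree q \<le> m" for p q :: "'a poly" and k m
    proof -
      have "degree (q * q) \<le> m + m" using degree_mult_le[of q q] that(2) by linarith
      thus ?thesis using coeff_mult_top[OF that(1), of "q * q"] coeff_mult_top[OF that(2) that(2)]
        by (simp add: power2_eq_square)
    qed
    \<comment> \<open>All three summands of \<open>M * h\<close> have nominal degree
      \<open>3 * n + 3\<close>. The coefficient there is the one of \<open>h\<close> in degree
      \<open>3 * n + 1\<close>, which is 0 for constant \<open>h\<close>: this is the zero at
      infinity.\<close>
    have "coeff (M * h) (Suc (Suc (Suc (3 * n)))) = 0" 
      using \<open>degree h = 0\<close> by (simp add: cM coeff_eq_0)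
    moreover have "M * h = V1 * w1\<^sup>2 + M * (v2 * w2\<^sup>2) + M * (v3 * w3\<^sup>2)"
      unfolding h_def M_def V1_def by (simp add: algebra_simps)
    ultimately have "X * \<omega>1\<^sup>2 + Y * (\<omega> a21 a22 a23)\<^sup>2 + Z * (\<omega> a31 a32 a33)\<^sup>2 = 0"
      using csq[OF dv(1) deg_w1] csq[OF dv(2) row2(2)] csq[OF dv(3) row3(2)] w1 row2(3) row3(3)
      by (simp add: cM n X_def Y_def Z_def three_n)
    moreover obtain x y z where xyz: "x\<^sup>2 = X" "y\<^sup>2 = Y" "z\<^sup>2 = Z"
      using square_root_exists by metis
    ultimately have "(x * \<omega>1 + y * \<omega> a21 a22 a23 + z * \<omega> a31 a32 a33)\<^sup>2 = 0"
      by (simp only: square_add_char2[OF two] power_mult_distrib)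
    hence "cubic_form (coeff a11 3) (coeff a12 1) (coeff a13 1) (coeff a21 2)
      (coeff a22 0) (coeff a23 0) (coeff a31 2) (coeff a32 0) (coeff a33 0) 0 x y z = 0"
      unfolding cubic_form_def \<omega>1_def \<omega>_def xyz by simp
    moreover have "cubic_critical (coeff a11 4) (coeff a12 2) (coeff a13 2) (coeff a21 3)
      (coeff a22 1) (coeff a23 1) (coeff a31 3) (coeff a32 1) (coeff a33 1) 0 x y z"
      unfolding cubic_critical_def xyz using L1 row2(1) row3(1) by simp
    moreover have "(x, y, z) \<noteq> (0, 0, 0)"
      using top_nz xyz unfolding X_def Y_def Z_def by auto
    ultimately show ?thesis by blast
  qed
qed

section \<open>Polynomials on projective 3-space\<close>

lemma infinite_UNIV_alg_closed: "infinite (UNIV :: 'a::alg_closed_field set)"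
proof
  assume fin: "finite (UNIV :: 'a set)"
  \<comment> \<open>Euclid's argument: this nonconstant polynomial would take the value 1
    everywhere.\<close>
  define p where "p = (\<Prod>a\<in>(UNIV :: 'a set). [:-a, 1:]) + 1"
  have "degree (\<Prod>a\<in>(UNIV :: 'a set). [:-a, 1:]) = card (UNIV :: 'a set)"
    by (subst degree_prod_eq_sum_degree) (auto simp: fin)
  moreover have "card (UNIV :: 'a set) > 0" using fin by (simp add: finite_UNIV_card_ge_0)
  ultimately have "degree p > 0" unfolding p_def by (simp add: degree_add_eq_left)
  then obtain x where "poly p x = 0" using alg_closed_imp_poly_has_root by blast
  moreover have "poly (\<Prod>a\<in>(UNIV :: 'a set). [:-a, 1:]) x = 0"
    by (simp add: poly_prod fin prod_zero_iff)
  ultimately show False unfolding p_def by simp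
qed

lemma poly_eqI_infinite:
  fixes p q :: "'a::idom poly"
  assumes "infinite S" "\<And>s. s \<in> S \<Longrightarrow> poly p s = poly q s"
  shows "p = q"
  using poly_eq_0_if_infinite_roots[OF assms(1), of "p - q"] assms(2) by simp

section \<open>Evaluation as a ring homomorphism\<close>

lemma eval_superset:
  assumes "finite S" "Poly_Mapping.keys p \<subseteq> S"
  shows "eval p v = (\<Sum>m\<in>S. Poly_Mapping.lookup p m * (\<Prod>i\<in>UNIV. v $ i ^ Poly_Mapping.lookup m i))"
  unfolding eval_def using assms by (intro sum.mono_neutral_left) (auto simp: in_keys_iff)

lemma eval_0 [simp]: "eval 0 v = 0"
  by (simp add: eval_def)

lemma eval_add: "eval (p + q) v = eval p v + eval q v"
proof -
  let ?S = "Poly_Mapping.keys p \<union> Poly_Mapping.keys q"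
  have "eval (p + q) v = (\<Sum>m\<in>?S. Poly_Mapping.lookup (p + q) m * (\<Prod>i\<in>UNIV. v $ i ^ Poly_Mapping.lookup m i))"
    by (rule eval_superset) (use keys_add[of p q] in auto)
  also have "\<dots> = eval p v + eval q v"
    unfolding eval_superset[of ?S p v, simplified] eval_superset[of ?S q v, simplified]
    by (simp add: lookup_add sum.distrib ring_distribs)
  finally show ?thesis .
qed

lemma eval_sum: "eval (sum f A) v = (\<Sum>a\<in>A. eval (f a) v)"
  by (induction A rule: infinite_finite_induct) (auto simp: eval_add)

lemma eval_single: "eval (Poly_Mapping.single m c) v = c * (\<Prod>i\<in>UNIV. v $ i ^ Poly_Mapping.lookup m i)"
  by (cases "c = 0") (auto simp: eval_def)

lemma poly_mapping_sum_singles: "p = (\<Sum>m\<in>Poly_Mapping.keys p. Poly_Mapping.single m (Poly_Mapping.lookup p m))"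
  by (rule poly_mapping_eqI) (simp add: lookup_sum lookup_single when_def in_keys_iff)

lemma eval_mult: "eval (p * q) v = eval p v * eval q v"
proof -
  have "p * q = (\<Sum>m\<in>Poly_Mapping.keys p. \<Sum>n\<in>Poly_Mapping.keys q.
      Poly_Mapping.single (m + n) (Poly_Mapping.lookup p m * Poly_Mapping.lookup q n))"
    by (subst poly_mapping_sum_singles[of p], subst poly_mapping_sum_singles[of q])
       (simp add: sum_product mult_single)
  hence "eval (p * q) v = eval (\<Sum>m\<in>Poly_Mapping.keys p. \<Sum>n\<in>Poly_Mapping.keys q.
      Poly_Mapping.single (m + n) (Poly_Mapping.lookup p m * Poly_Mapping.lookup q n)) v" by (rule arg_cong)
  also have "\<dots> = eval p v * eval q v"
    unfolding eval_sum eval_single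
    by (simp add: eval_def sum_product lookup_add power_add prod.distrib mult_ac)
  finally show ?thesis .
qed

lemma pderiv_sum: "pderiv (sum f A) = (\<Sum>a\<in>A. pderiv (f a))"
  by (induction A rule: infinite_finite_induct) (auto simp: pderiv_add)

lemma eval_diff: "eval (p - q) v = eval p v - eval q v"
  using eval_add[of "p - q" q v] by simp

section \<open>Directional derivatives along lines\<close>

definition dirderiv :: "'k::field poly4 \<Rightarrow> 'k ^ 4 \<Rightarrow> 'k ^ 4 \<Rightarrow> 'k" where
  "dirderiv p P v = (\<Sum>i\<in>UNIV. v $ i * eval (partial i p) P)"

lemma dirderiv_add: "dirderiv p P (u + v) = dirderiv p P u + dirderiv p P v"
  by (simp add: dirderiv_def algebra_simps sum.distrib)

lemma dirderiv_scale: "dirderiv p P (a *s v) = a * dirderiv p P v"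
  by (simp add: dirderiv_def algebra_simps sum_distrib_left)

text \<open>The product rule for each monomial. Afterwards derivatives are read off as linear
  coefficients in \<open>s\<close>, without expanding \<open>partial\<close>.\<close>

lemma eval_on_line:
  fixes p :: "'k::field poly4"
  obtains q where "\<And>s. eval p (P + s *s v) = poly q s" "coeff q 0 = eval p P" "coeff q 1 = dirderiv p P v"
proof
  define mon where "mon m = (\<Prod>i\<in>UNIV. [:P $ i, v $ i:] ^ Poly_Mapping.lookup m i)" for m :: "4 \<Rightarrow>\<^sub>0 nat"
  define q where "q = (\<Sum>m\<in>Poly_Mapping.keys p. smult (Poly_Mapping.lookup p m) (mon m))"
  show ev: "eval p (P + s *s v) = poly q s" for s
    by (simp add: eval_def q_def mon_def poly_sum poly_prod algebra_simps)
  show "coeff q 0 = eval p P" using ev[of 0] by (simp add: poly_0_coeff_0)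
  have "coeff q 1 = poly (pderiv q) 0" by (simp add: poly_0_coeff_0 coeff_pderiv)
  also have "\<dots> = (\<Sum>m\<in>Poly_Mapping.keys p. Poly_Mapping.lookup p m * poly (pderiv (mon m)) 0)"
    unfolding q_def by (simp add: pderiv_sum pderiv_smult poly_sum)
  also have "\<dots> = (\<Sum>m\<in>Poly_Mapping.keys p. Poly_Mapping.lookup p m *
      (\<Sum>i\<in>UNIV. v $ i * (of_nat (Poly_Mapping.lookup m i) *
         (\<Prod>j\<in>UNIV. P $ j ^ Poly_Mapping.lookup (m - Poly_Mapping.single i 1) j))))"
  proof (intro sum.cong refl arg_cong2[of _ _ _ _ "(*)"])
    fix m :: "4 \<Rightarrow>\<^sub>0 nat"
    have "poly (pderiv (mon m)) 0 = (\<Sum>i\<in>UNIV. (\<Prod>j\<in>UNIV - {i}. P $ j ^ Poly_Mapping.lookup m j) *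
        (of_nat (Poly_Mapping.lookup m i) * P $ i ^ (Poly_Mapping.lookup m i - 1) * v $ i))"
      unfolding mon_def by (simp add: pderiv_prod pderiv_power poly_sum poly_prod pderiv_pCons mult_ac)
    also have "\<dots> = (\<Sum>i\<in>UNIV. v $ i * (of_nat (Poly_Mapping.lookup m i) *
         (\<Prod>j\<in>UNIV. P $ j ^ Poly_Mapping.lookup (m - Poly_Mapping.single i 1) j)))"
    proof (intro sum.cong refl)
      fix i :: 4
      \<comment> \<open>An exponent 0 at \<open>i\<close> is truncated to 0 on both sides, so no
        case distinction is needed.\<close>
      have "(\<Prod>j\<in>UNIV. P $ j ^ Poly_Mapping.lookup (m - Poly_Mapping.single i 1) j)
         = P $ i ^ (Poly_Mapping.lookup m i - 1) * (\<Prod>j\<in>UNIV - {i}. P $ j ^ Poly_Mapping.lookup m j)"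
        by (subst prod.remove[of _ i]) (auto simp: lookup_minus lookup_single intro!: prod.cong)
      thus "(\<Prod>j\<in>UNIV - {i}. P $ j ^ Poly_Mapping.lookup m j) *
        (of_nat (Poly_Mapping.lookup m i) * P $ i ^ (Poly_Mapping.lookup m i - 1) * v $ i) =
        v $ i * (of_nat (Poly_Mapping.lookup m i) *
         (\<Prod>j\<in>UNIV. P $ j ^ Poly_Mapping.lookup (m - Poly_Mapping.single i 1) j))"
        by (simp add: mult_ac)
    qed
    finally show "poly (pderiv (mon m)) 0 = (\<Sum>i\<in>UNIV. v $ i * (of_nat (Poly_Mapping.lookup m i) *
         (\<Prod>j\<in>UNIV. P $ j ^ Poly_Mapping.lookup (m - Poly_Mapping.single i 1) j)))" .
  qed
  also have "\<dots> = dirderiv p P v"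
    unfolding dirderiv_def partial_def eval_sum eval_single sum_distrib_left
    by (subst sum.swap) (simp add: mult_ac)
  finally show "coeff q 1 = dirderiv p P v" .
qed

text \<open>The field is infinite, so a polynomial in \<open>s\<close> is determined by its values;
  any explicit expansion along the line computes the derivative.\<close>

lemma dirderiv_eqI:
  fixes p :: "'k::alg_closed_field poly4"
  assumes "\<And>s. eval p (P + s *s v) = poly r s"
  shows "dirderiv p P v = coeff r 1"
proof -
  obtain q where q: "\<And>s. eval p (P + s *s v) = poly q s" "coeff q 1 = dirderiv p P v"
    using eval_on_line[of p P v] by metis
  have "q = r" using assms q(1) by (intro poly_eqI_infinite[OF infinite_UNIV_alg_closed]) simp
  thus ?thesis using q by simp
qed

section \<open>Homogeneous forms in coordinates adapted to the line\<close>

text \<open>Forms are functions of the four coordinates here: a change of basis is then a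
  composition, and induction replaces the substitution of linear forms into a
  \<open>poly4\<close>.\<close>

inductive form4 :: "nat \<Rightarrow> ('a::comm_ring_1 \<Rightarrow> 'a \<Rightarrow> 'a \<Rightarrow> 'a \<Rightarrow> 'a) \<Rightarrow> bool" where
  zero: "form4 d (\<lambda>_ _ _ _. 0)"
| add: "form4 d f \<Longrightarrow> form4 d g \<Longrightarrow> form4 d (\<lambda>x0 x1 x2 x3. f x0 x1 x2 x3 + g x0 x1 x2 x3)"
| monomial: "a + b + c + e = d \<Longrightarrow> form4 d (\<lambda>x0 x1 x2 x3. k * x0 ^ a * x1 ^ b * x2 ^ c * x3 ^ e)"

lemma form4_mult_monomial:
  "form4 d f \<Longrightarrow> a + b + c + e = d' \<Longrightarrow>
    form4 (d + d') (\<lambda>x0 x1 x2 x3. f x0 x1 x2 x3 * (k * x0 ^ a * x1 ^ b * x2 ^ c * x3 ^ e))"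
proof (induction rule: form4.induct)
  case (zero d)
  thus ?case using form4.zero by simp
next
  case (add d f g)
  thus ?case unfolding distrib_right by (intro form4.add) auto
next
  case (monomial a' b' c' e' d k')
  have "form4 (d + d') (\<lambda>x0 x1 x2 x3. (k' * k) * x0 ^ (a' + a) * x1 ^ (b' + b) * x2 ^ (c' + c) * x3 ^ (e' + e))"
    by (rule form4.monomial) (use monomial in auto)
  thus ?case by (simp add: power_add mult_ac)
qed

lemma form4_mult:
  "form4 d' g \<Longrightarrow> form4 d f \<Longrightarrow> form4 (d + d') (\<lambda>x0 x1 x2 x3. f x0 x1 x2 x3 * g x0 x1 x2 x3)"
proof (induction rule: form4.induct)
  case (zero d)
  thus ?case using form4.zero by simp
next
  case (add d f g)
  thus ?case unfolding distrib_left by (intro form4.add) auto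
next
  case (monomial a b c e d k)
  thus ?case using form4_mult_monomial by blast
qed

lemma form4_power: "form4 d f \<Longrightarrow> form4 (n * d) (\<lambda>x0 x1 x2 x3. f x0 x1 x2 x3 ^ n)"
proof (induction n)
  case 0
  show ?case using form4.monomial[of 0 0 0 0 0 1] by simp
next
  case (Suc n)
  from form4_mult[OF Suc.prems Suc.IH[OF Suc.prems]] show ?case by (simp add: mult_ac add_ac)
qed

lemma form4_prod:
  "finite A \<Longrightarrow> (\<And>i. i \<in> A \<Longrightarrow> form4 (d i) (f i)) \<Longrightarrow>
    form4 (sum d A) (\<lambda>x0 x1 x2 x3. \<Prod>i\<in>A. f i x0 x1 x2 x3)"
proof (induction A rule: finite_induct)
  case empty
  show ?case using form4.monomial[of 0 0 0 0 0 1] by simp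
next
  case (insert i A)
  have "form4 (d i + sum d A) (\<lambda>x0 x1 x2 x3. f i x0 x1 x2 x3 * (\<Prod>i\<in>A. f i x0 x1 x2 x3))"
    by (rule form4_mult) (use insert in auto)
  thus ?case using insert by simp
qed

lemma form4_sum:
  "(\<And>i. i \<in> A \<Longrightarrow> form4 d (f i)) \<Longrightarrow> form4 d (\<lambda>x0 x1 x2 x3. \<Sum>i\<in>A. f i x0 x1 x2 x3)"
  by (induction A rule: infinite_finite_induct) (auto intro: form4.intros)

lemma form4_eval:
  fixes p :: "'k::field poly4"
  assumes "homogeneous d p"
  shows "form4 d (\<lambda>x0 x1 x2 x3. eval p (x0 *s u0 + x1 *s u1 + x2 *s u2 + x3 *s u3))"
  unfolding eval_def
proof (rule form4_sum)
  fix m assume m: "m \<in> Poly_Mapping.keys p"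
  have lin: "form4 1 (\<lambda>x0 x1 x2 x3. (x0 *s u0 + x1 *s u1 + x2 *s u2 + x3 *s u3) $ i)" for i
    using form4.add[OF form4.add[OF form4.add[OF form4.monomial[of 1 0 0 0 1 "u0 $ i"]
      form4.monomial[of 0 1 0 0 1 "u1 $ i"]] form4.monomial[of 0 0 1 0 1 "u2 $ i"]] form4.monomial[of 0 0 0 1 1 "u3 $ i"]]
    by (simp add: mult_ac)
  have "form4 (\<Sum>i\<in>UNIV. Poly_Mapping.lookup m i * 1) (\<lambda>x0 x1 x2 x3. \<Prod>i\<in>UNIV.
      (x0 *s u0 + x1 *s u1 + x2 *s u2 + x3 *s u3) $ i ^ Poly_Mapping.lookup m i)"
    by (intro form4_prod form4_power lin) simp
  moreover have "(\<Sum>i\<in>UNIV. Poly_Mapping.lookup m i * 1) = d"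
    using assms m by (simp add: homogeneous_def)
  ultimately have "form4 d (\<lambda>x0 x1 x2 x3. \<Prod>i\<in>UNIV.
      (x0 *s u0 + x1 *s u1 + x2 *s u2 + x3 *s u3) $ i ^ Poly_Mapping.lookup m i)" by simp
  from form4_mult[OF this form4.monomial[of 0 0 0 0 0 "Poly_Mapping.lookup p m"]]
  show "form4 d (\<lambda>x0 x1 x2 x3. Poly_Mapping.lookup p m * (\<Prod>i\<in>UNIV.
      (x0 *s u0 + x1 *s u1 + x2 *s u2 + x3 *s u3) $ i ^ Poly_Mapping.lookup m i))" by simp
qed

text \<open>The homogenization \<open>x0^n p(x1/x0)\<close>; it encodes binary forms of degree
  \<open>n\<close> by univariate polynomials of degree at most \<open>n\<close>.\<close>

definition bform :: "nat \<Rightarrow> 'a::comm_ring_1 poly \<Rightarrow> 'a \<Rightarrow> 'a \<Rightarrow> 'a" where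
  "bform n p x0 x1 = (\<Sum>i\<le>n. coeff p i * x1 ^ i * x0 ^ (n - i))"

lemma bform_zero: "bform n 0 x0 x1 = 0"
  by (simp add: bform_def)

text \<open>Monomials are collected by their powers of \<open>x2\<close> and \<open>x3\<close>, the
  coordinates along the line; the coefficients are binary forms in \<open>x0\<close> and
  \<open>x1\<close>, the coordinates on the base of the pencil.\<close>

lemma form4_rep:
  "form4 d f \<Longrightarrow> \<exists>P. (\<forall>c e. c + e \<le> d \<longrightarrow> degree (P c e) \<le> d - c - e) \<and>
    (\<forall>x0 x1 x2 x3. f x0 x1 x2 x3 = (\<Sum>c\<le>d. \<Sum>e\<le>d-c. bform (d-c-e) (P c e) x0 x1 * x2 ^ c * x3 ^ e))"
proof (induction rule: form4.induct)
  case (zero d)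
  show ?case by (rule exI[of _ "\<lambda>_ _. 0"]) (simp add: bform_def)
next
  case (add d f g)
  from add.IH(1) obtain P where P: "\<And>c e. c + e \<le> d \<Longrightarrow> degree (P c e) \<le> d - c - e"
    "\<And>x0 x1 x2 x3. f x0 x1 x2 x3 = (\<Sum>c\<le>d. \<Sum>e\<le>d-c. bform (d-c-e) (P c e) x0 x1 * x2 ^ c * x3 ^ e)"
    by (elim exE conjE) blast
  from add.IH(2) obtain Q where Q: "\<And>c e. c + e \<le> d \<Longrightarrow> degree (Q c e) \<le> d - c - e"
    "\<And>x0 x1 x2 x3. g x0 x1 x2 x3 = (\<Sum>c\<le>d. \<Sum>e\<le>d-c. bform (d-c-e) (Q c e) x0 x1 * x2 ^ c * x3 ^ e)"
    by (elim exE conjE) blast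
  show ?case
  proof (intro exI[of _ "\<lambda>c e. P c e + Q c e"] conjI allI impI)
    fix c e :: nat assume "c + e \<le> d"
    thus "degree (P c e + Q c e) \<le> d - c - e" using P(1) Q(1) by (intro degree_add_le) auto
  qed (simp add: P(2) Q(2) bform_def algebra_simps sum.distrib)
next
  case (monomial a b c e d k)
  show ?case
  proof (intro exI[of _ "\<lambda>c' e'. if c' = c \<and> e' = e then monom k b else 0"] conjI allI impI)
    fix c' e' assume "c' + e' \<le> d"
    show "degree (if c' = c \<and> e' = e then monom k b else 0) \<le> d - c' - e'"
      using monomial by (auto intro: order.trans[OF degree_monom_le])
  next
    fix x0 x1 x2 x3 :: 'a
    have bf: "bform (d - c - e) (monom k b) x0 x1 = k * x1 ^ b * x0 ^ a"
    proof -
      have "bform (d - c - e) (monom k b) x0 x1 = (\<Sum>i\<in>{b}. coeff (monom k b) i * x1 ^ i * x0 ^ (d - c - e - i))"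
        unfolding bform_def using monomial by (intro sum.mono_neutral_right) auto
      also have "\<dots> = k * x1 ^ b * x0 ^ a" using monomial by auto
      finally show ?thesis .
    qed
    have "(\<Sum>c'\<le>d. \<Sum>e'\<le>d-c'. bform (d-c'-e') (if c' = c \<and> e' = e then monom k b else 0) x0 x1 * x2 ^ c' * x3 ^ e')
       = (\<Sum>c'\<le>d. if c' = c then k * x1 ^ b * x0 ^ a * x2 ^ c * x3 ^ e else 0)"
    proof (intro sum.cong refl)
      fix c' assume "c' \<in> {..d}"
      show "(\<Sum>e'\<le>d-c'. bform (d-c'-e') (if c' = c \<and> e' = e then monom k b else 0) x0 x1 * x2 ^ c' * x3 ^ e')
        = (if c' = c then k * x1 ^ b * x0 ^ a * x2 ^ c * x3 ^ e else 0)"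
      proof (cases "c' = c")
        case True
        have "(\<Sum>e'\<le>d-c. bform (d-c-e') (if e' = e then monom k b else 0) x0 x1 * x2 ^ c * x3 ^ e')
          = (\<Sum>e'\<le>d-c. if e' = e then k * x1 ^ b * x0 ^ a * x2 ^ c * x3 ^ e else 0)"
          by (intro sum.cong refl) (simp add: bf bform_zero del: diff_diff_left)
        thus ?thesis using True monomial by simp
      qed (simp add: bform_def)
    qed
    also have "\<dots> = k * x0 ^ a * x1 ^ b * x2 ^ c * x3 ^ e" using monomial by (simp add: mult_ac)
    finally show "k * x0 ^ a * x1 ^ b * x2 ^ c * x3 ^ e = (\<Sum>c'\<le>d. \<Sum>e'\<le>d-c'.
      bform (d-c'-e') (if c' = c \<and> e' = e then monom k b else 0) x0 x1 * x2 ^ c' * x3 ^ e')" by simp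
  qed
qed

section \<open>The pencil of planes through the line\<close>

definition is_basis4 :: "'k::field ^ 4 \<Rightarrow> 'k ^ 4 \<Rightarrow> 'k ^ 4 \<Rightarrow> 'k ^ 4 \<Rightarrow> bool" where
  "is_basis4 u0 u1 u2 u3 \<longleftrightarrow> (\<forall>v. \<exists>x0 x1 x2 x3. v = x0 *s u0 + x1 *s u1 + x2 *s u2 + x3 *s u3) \<and>
    (\<forall>x0 x1 x2 x3. x0 *s u0 + x1 *s u1 + x2 *s u2 + x3 *s u3 = 0 \<longrightarrow> x0 = 0 \<and> x1 = 0 \<and> x2 = 0 \<and> x3 = 0)"

text \<open>Squaring is additive in characteristic 2, so the factors 2 and 3 disappear from the
  expansion. Its linear coefficient pairs the direction with the gradient occurring in
  \<open>cubic_critical\<close>.\<close>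

lemma cubic_form_line:
  fixes x y z :: "'a::field"
  assumes two: "(2::'a) = 0"
  shows "cubic_form a11 a12 a13 a21 a22 a23 a31 a32 a33 c (x + s * x') (y + s * y') (z + s * z') =
    poly [: cubic_form a11 a12 a13 a21 a22 a23 a31 a32 a33 c x y z,
      x' * (a11 * x\<^sup>2 + a12 * y\<^sup>2 + a13 * z\<^sup>2 + c * (y * z)) +
      y' * (a21 * x\<^sup>2 + a22 * y\<^sup>2 + a23 * z\<^sup>2 + c * (x * z)) +
      z' * (a31 * x\<^sup>2 + a32 * y\<^sup>2 + a33 * z\<^sup>2 + c * (x * y)),
      x * (a11 * x'\<^sup>2 + a12 * y'\<^sup>2 + a13 * z'\<^sup>2) + y * (a21 * x'\<^sup>2 + a22 * y'\<^sup>2 + a23 * z'\<^sup>2) +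
      z * (a31 * x'\<^sup>2 + a32 * y'\<^sup>2 + a33 * z'\<^sup>2) + c * (x * y' * z' + x' * y * z' + x' * y' * z),
      cubic_form a11 a12 a13 a21 a22 a23 a31 a32 a33 c x' y' z' :] s"
  unfolding cubic_form_def square_add_char2[OF two] power_mult_distrib
  by (simp add: algebra_simps power2_eq_square)

text \<open>Euler's relation: the gradient yields the mixed term three times instead of once, and
  the excess has the factor 2.\<close>

lemma cubic_form_eq_0_if_cubic_critical:
  fixes x y z :: "'a::field"
  assumes "(2::'a) = 0" and "cubic_critical a11 a12 a13 a21 a22 a23 a31 a32 a33 c x y z"
  shows "cubic_form a11 a12 a13 a21 a22 a23 a31 a32 a33 c x y z = 0"
proof -
  have "cubic_form a11 a12 a13 a21 a22 a23 a31 a32 a33 c x y z =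
      x * (a11 * x\<^sup>2 + a12 * y\<^sup>2 + a13 * z\<^sup>2 + c * (y * z)) +
      y * (a21 * x\<^sup>2 + a22 * y\<^sup>2 + a23 * z\<^sup>2 + c * (x * z)) +
      z * (a31 * x\<^sup>2 + a32 * y\<^sup>2 + a33 * z\<^sup>2 + c * (x * y)) - 2 * c * x * y * z"
    unfolding cubic_form_def by (simp add: algebra_simps)
  thus ?thesis using assms unfolding cubic_critical_def by simp
qed

definition pencil_form :: "'k::field poly4 \<Rightarrow> 'k ^ 4 \<Rightarrow> 'k ^ 4 \<Rightarrow> 'k ^ 4 \<Rightarrow> 'k ^ 4 \<Rightarrow> 'k poly \<Rightarrow> 'k poly \<Rightarrow> 'k poly
    \<Rightarrow> 'k poly \<Rightarrow> 'k poly \<Rightarrow> 'k poly \<Rightarrow> 'k poly \<Rightarrow> 'k poly \<Rightarrow> 'k poly \<Rightarrow> 'k poly \<Rightarrow> bool" where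
  "pencil_form F u0 u1 u2 u3 a11 a12 a13 a21 a22 a23 a31 a32 a33 c \<longleftrightarrow>
    (\<forall>t x y z. eval F (x *s u0 + (t * x) *s u1 + y *s u2 + z *s u3) =
      x * cubic_form (poly a11 t) (poly a12 t) (poly a13 t) (poly a21 t) (poly a22 t) (poly a23 t)
        (poly a31 t) (poly a32 t) (poly a33 t) (poly c t) x y z)"

text \<open>All derivatives of \<open>F = x Q_t\<close> vanish at \<open>P\<close>. The gradient of
  \<open>Q_t\<close> handles the directions \<open>u2\<close> and \<open>u3\<close>. Away from the
  line, moving \<open>t\<close> handles \<open>u1\<close>, and homogeneity handles
  \<open>u0\<close>. On the line the two transversal directions are compared in two planes of the
  pencil, which uses the degree bounds.\<close>

lemma singular_point_contradiction:
  fixes F :: "'k::alg_closed_field poly4"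
  assumes two: "(2::'k) = 0" and smooth: "smooth_quartic F" and basis: "is_basis4 u0 u1 u2 u3"
    and form: "pencil_form F u0 u1 u2 u3 a11 a12 a13 a21 a22 a23 a31 a32 a33 c"
    and deg: "degree a22 \<le> 1" "degree a23 \<le> 1" "degree a32 \<le> 1" "degree a33 \<le> 1"
    and nz: "(x, y, z) \<noteq> (0, 0, 0)"
    and sing: "cubic_critical (poly a11 t) (poly a12 t) (poly a13 t) (poly a21 t) (poly a22 t) (poly a23 t)
        (poly a31 t) (poly a32 t) (poly a33 t) (poly c t) x y z"
    and sing': "cubic_form (poly (pderiv a11) t) (poly (pderiv a12) t) (poly (pderiv a13) t) (poly (pderiv a21) t)
      (poly (pderiv a22) t) (poly (pderiv a23) t) (poly (pderiv a31) t) (poly (pderiv a32) t)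
      (poly (pderiv a33) t) (poly (pderiv c) t) x y z = 0"
  shows False
proof -
  define P where "P = x *s u0 + (t * x) *s u1 + y *s u2 + z *s u3"
  define q where "q t x y z = cubic_form (poly a11 t) (poly a12 t) (poly a13 t) (poly a21 t) (poly a22 t) (poly a23 t)
        (poly a31 t) (poly a32 t) (poly a33 t) (poly c t) x y z" for t x y z
  have F: "eval F (x *s u0 + (t * x) *s u1 + y *s u2 + z *s u3) = x * q t x y z" for t x y z
    using form unfolding pencil_form_def q_def by blast
  have "P \<noteq> 0" using basis nz unfolding is_basis4_def P_def by blast
  have q0: "q t x y z = 0" unfolding q_def by (rule cubic_form_eq_0_if_cubic_critical[OF two sing])
  have P0: "eval F P = 0" unfolding P_def F q0 by simp
  have d2: "dirderiv F P u2 = 0"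
  proof -
    have eq: "P + s *s u2 = x *s u0 + (t * x) *s u1 + (y + s * 1) *s u2 + (z + s * 0) *s u3" for s
      unfolding P_def by (simp add: vec_eq_iff algebra_simps)
    have "eval F (P + s *s u2) = x * q t (x + s * 0) (y + s * 1) (z + s * 0)" for s
      by (simp only: eq F mult_zero_right add_0_right mult_1_right add_0_left)
    from dirderiv_eqI[of F P u2 "smult x _", unfolded poly_smult, OF this[unfolded q_def cubic_form_line[OF two]]]
    show ?thesis using sing unfolding cubic_critical_def by simp
  qed
  have d3: "dirderiv F P u3 = 0"
  proof -
    have eq: "P + s *s u3 = x *s u0 + (t * x) *s u1 + (y + s * 0) *s u2 + (z + s * 1) *s u3" for s
      unfolding P_def by (simp add: vec_eq_iff algebra_simps)
    have "eval F (P + s *s u3) = x * q t (x + s * 0) (y + s * 0) (z + s * 1)" for s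
      by (simp only: eq F mult_zero_right add_0_right mult_1_right add_0_left)
    from dirderiv_eqI[of F P u3 "smult x _", unfolded poly_smult, OF this[unfolded q_def cubic_form_line[OF two]]]
    show ?thesis using sing unfolding cubic_critical_def by simp
  qed
  have "dirderiv F P u0 = 0 \<and> dirderiv F P u1 = 0"
  proof (cases "x = 0")
    case False
    have dP: "dirderiv F P P = 0"
    proof -
      have eq: "P + s *s P = (x + s * x) *s u0 + (t * (x + s * x)) *s u1 + (y + s * y) *s u2 + (z + s * z) *s u3" for s
        unfolding P_def by (simp add: vec_eq_iff algebra_simps)
      have *: "eval F (P + s *s P) = (x + s * x) * q t (x + s * x) (y + s * y) (z + s * z)" for s
      by (simp only: eq F mult_zero_right add_0_right mult_1_right add_0_left)
      have "q t (x + s * x) (y + s * y) (z + s * z) = (1 + s) ^ 3 * q t x y z" for s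
        unfolding q_def cubic_form_def by (simp add: algebra_simps power2_eq_square power3_eq_cube)
      hence "eval F (P + s *s P) = poly 0 s" for s unfolding * q0 by simp
      from dirderiv_eqI[of F P P 0, OF this] show ?thesis by simp
    qed
    have d1: "dirderiv F P u1 = 0"
    proof -
      define sh where "sh a = pcompose a [:t, 1:]" for a
      define r where "r = smult x (smult x (smult (x\<^sup>2) (sh a11) + smult (y\<^sup>2) (sh a12) + smult (z\<^sup>2) (sh a13)) +
        smult y (smult (x\<^sup>2) (sh a21) + smult (y\<^sup>2) (sh a22) + smult (z\<^sup>2) (sh a23)) +
        smult z (smult (x\<^sup>2) (sh a31) + smult (y\<^sup>2) (sh a32) + smult (z\<^sup>2) (sh a33)) + smult (x * y * z) (sh c))"
      have sh1: "coeff (sh a) 1 = poly (pderiv a) t" for a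
      proof -
        have "coeff (sh a) 1 = poly (pderiv (sh a)) 0" by (simp add: poly_0_coeff_0 coeff_pderiv)
        thus ?thesis unfolding sh_def pderiv_pcompose by (simp add: poly_pcompose pderiv_pCons)
      qed
      \<comment> \<open>This motion keeps \<open>x\<close>, \<open>y\<close>, \<open>z\<close> and
        only turns the plane, from parameter \<open>t\<close> to \<open>t + s\<close>.\<close>
      have eq: "P + s *s (x *s u1) = x *s u0 + ((t + s) * x) *s u1 + y *s u2 + z *s u3" for s
        unfolding P_def by (simp add: vec_eq_iff algebra_simps)
      have "eval F (P + s *s (x *s u1)) = x * q (t + s) x y z" for s
      by (simp only: eq F mult_zero_right add_0_right mult_1_right add_0_left)
      also have "x * q (t + s) x y z = poly r s" for s
        unfolding q_def cubic_form_def r_def sh_def by (simp add: poly_pcompose mult_ac)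
      finally have "dirderiv F P (x *s u1) = coeff r 1" by (rule dirderiv_eqI)
      also have "\<dots> = x * cubic_form (poly (pderiv a11) t) (poly (pderiv a12) t) (poly (pderiv a13) t) (poly (pderiv a21) t)
      (poly (pderiv a22) t) (poly (pderiv a23) t) (poly (pderiv a31) t) (poly (pderiv a32) t)
      (poly (pderiv a33) t) (poly (pderiv c) t) x y z"
        unfolding r_def cubic_form_def coeff_smult coeff_add sh1 by (simp add: mult_ac)
      finally show ?thesis using sing' False by (simp add: dirderiv_scale)
    qed
    have "x * dirderiv F P u0 = 0"
      using dP d1 d2 d3 unfolding P_def[symmetric]
      by (subst (asm) P_def) (simp add: dirderiv_add dirderiv_scale)
    thus ?thesis using False d1 by simp
  next
    case True
    \<comment> \<open>On the line the factor \<open>x\<close> of \<open>F\<close> vanishes to first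
      order. Leaving the line inside the plane with parameter \<open>\<tau>\<close>, the derivative
      of \<open>F\<close> is the cubic of that plane evaluated at \<open>P\<close>.\<close>
    have y3: "y * (poly a22 \<tau> * y\<^sup>2 + poly a23 \<tau> * z\<^sup>2) + z * (poly a32 \<tau> * y\<^sup>2 + poly a33 \<tau> * z\<^sup>2) = dirderiv F P (u0 + \<tau> *s u1)" for \<tau>
    proof -
      have eq: "P + s *s (u0 + \<tau> *s u1) = s *s u0 + (\<tau> * s) *s u1 + y *s u2 + z *s u3" for s
        unfolding P_def True by (simp add: vec_eq_iff algebra_simps)
      have *: "eval F (P + s *s (u0 + \<tau> *s u1)) = s * q \<tau> (0 + s * 1) (y + s * 0) (z + s * 0)" for s
      by (simp only: eq F mult_zero_right add_0_right mult_1_right add_0_left)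
      have **: "s * poly p s = poly (pCons 0 p) s" for s and p :: "'k poly" by simp
      from dirderiv_eqI[OF *[unfolded q_def cubic_form_line[OF two] **]]
      show ?thesis by (simp add: cubic_form_def)
    qed
    have gy: "poly a22 t * y\<^sup>2 + poly a23 t * z\<^sup>2 = 0" and gz: "poly a32 t * y\<^sup>2 + poly a33 t * z\<^sup>2 = 0"
      using sing True by (simp_all add: cubic_critical_def)
    \<comment> \<open>The entries that matter for \<open>x = 0\<close> are affine in
      \<open>t\<close>, so passing to \<open>t + 1\<close> adds exactly the derivative. The
      directions \<open>u0 + t u1\<close> and \<open>u0 + (t + 1) u1\<close> span the same plane as
      \<open>u0\<close> and \<open>u1\<close>.\<close>
    have lin: "poly a (t + 1) = poly a t + poly (pderiv a) t" if "degree a \<le> 1" for a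
    proof -
      have a: "a = [:coeff a 0, coeff a 1:]"
        using that by (intro poly_eqI) (auto simp: coeff_pCons coeff_eq_0 split: nat.split)
      show ?thesis by (subst (1 2 3) a) (simp add: pderiv_pCons algebra_simps)
    qed
    have e0: "dirderiv F P (u0 + t *s u1) = 0"
      using y3[of t] gy gz by simp
    have "dirderiv F P (u0 + (t + 1) *s u1) = y * (poly a22 t * y\<^sup>2 + poly a23 t * z\<^sup>2) + z * (poly a32 t * y\<^sup>2 + poly a33 t * z\<^sup>2) +
      cubic_form (poly (pderiv a11) t) (poly (pderiv a12) t) (poly (pderiv a13) t) (poly (pderiv a21) t)
      (poly (pderiv a22) t) (poly (pderiv a23) t) (poly (pderiv a31) t) (poly (pderiv a32) t)
      (poly (pderiv a33) t) (poly (pderiv c) t) x y z"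
      unfolding y3[symmetric] lin[OF deg(1)] lin[OF deg(2)] lin[OF deg(3)] lin[OF deg(4)] cubic_form_def True
      by (simp add: algebra_simps)
    hence e1: "dirderiv F P (u0 + (t + 1) *s u1) = 0" unfolding gy gz sing' by simp
    have "dirderiv F P (u0 + (t + 1) *s u1) = dirderiv F P (u0 + t *s u1) + dirderiv F P u1"
      by (simp add: dirderiv_add dirderiv_scale algebra_simps)
    hence "dirderiv F P u1 = 0" using e0 e1 by simp
    thus ?thesis using e0 by (simp add: dirderiv_add dirderiv_scale)
  qed
  hence d01: "dirderiv F P u0 = 0" "dirderiv F P u1 = 0" by auto
  have d: "dirderiv F P v = 0" for v
  proof -
    obtain x0 x1 x2 x3 where v: "v = x0 *s u0 + x1 *s u1 + x2 *s u2 + x3 *s u3"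
      using basis unfolding is_basis4_def by blast
    show ?thesis unfolding v by (simp add: dirderiv_add dirderiv_scale d01 d2 d3)
  qed
  have "eval (partial i F) P = 0" for i
  proof -
    have "dirderiv F P (axis i 1) = (\<Sum>j\<in>UNIV. if j = i then eval (partial i F) P else 0)"
      unfolding dirderiv_def by (intro sum.cong) (auto simp: axis_def)
    thus ?thesis using d by simp
  qed
  thus False using smooth P0 \<open>P \<noteq> 0\<close> unfolding smooth_quartic_def by blast
qed

lemma eval_linear:
  fixes M :: "'k::field poly4"
  assumes "homogeneous 1 M"
  shows "eval M (x *s u + y *s v + z *s w) = x * eval M u + y * eval M v + z * eval M w"
proof -
  \<comment> \<open>Only three vectors are combined; the zero vector fills the second place of the
    normal form.\<close>
  obtain P where P: "\<And>x0 x1 x2 x3. eval M (x0 *s u + x1 *s 0 + x2 *s v + x3 *s w) =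
      (\<Sum>c\<le>1. \<Sum>e\<le>1-c. bform (1-c-e) (P c e) x0 x1 * x2 ^ c * x3 ^ e)"
    using form4_rep[OF form4_eval[OF assms, of u 0 v w]] by (elim exE conjE) blast
  define a b c where "a = coeff (P 0 0) 0" and "b = coeff (P 1 0) 0" and "c = coeff (P 0 1) 0"
  have lin: "eval M (x *s u + y *s v + z *s w) = a * x + b * y + c * z" for x y z
    using P[of x 0 y z] by (simp add: bform_def a_def b_def c_def algebra_simps)
  show ?thesis using lin[of x y z] lin[of 1 0 0] lin[of 0 1 0] lin[of 0 0 1] by simp
qed

section \<open>The two affine charts of the pencil\<close>

text \<open>This is \<open>t^n p(1/t)\<close> with \<open>n\<close> as nominal degree: if
  \<open>coeff p n\<close> is 0, the result vanishes at 0.\<close>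

definition reversed :: "nat \<Rightarrow> 'a::comm_ring_1 poly \<Rightarrow> 'a poly" where
  "reversed n p = (\<Sum>i\<le>n. monom (coeff p (n - i)) i)"

lemma coeff_reversed: "coeff (reversed n p) k = (if k \<le> n then coeff p (n - k) else 0)"
  by (simp add: reversed_def coeff_sum coeff_monom)

lemma degree_reversed: "degree (reversed n p) \<le> n"
  by (rule degree_le) (simp add: coeff_reversed)

lemma poly_reversed_0: "poly (reversed n p) 0 = coeff p n"
  by (simp add: poly_0_coeff_0 coeff_reversed)

lemma poly_pderiv_reversed_0: "n > 0 \<Longrightarrow> poly (pderiv (reversed n p)) 0 = coeff p (n - 1)"
  by (simp add: poly_0_coeff_0 coeff_pderiv coeff_reversed)

lemma bform_chart:
  assumes "degree p \<le> n"
  shows "bform n p x (t * x) = x ^ n * poly p t"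
proof -
  have "poly p t = (\<Sum>i\<le>n. coeff p i * t ^ i)"
    unfolding poly_altdef using assms by (intro sum.mono_neutral_left) (auto simp: coeff_eq_0)
  moreover have "x ^ i * x ^ (n - i) = x ^ n" if "i \<le> n" for i
    using that by (simp flip: power_add)
  ultimately show ?thesis
    by (simp add: bform_def sum_distrib_left power_mult_distrib mult_ac)
qed

lemma bform_chart_reversed: "bform n p (t * x) x = x ^ n * poly (reversed n p) t"
proof -
  have "bform n p (t * x) x = (\<Sum>i\<le>n. coeff p (n - i) * x ^ (n - i) * (t * x) ^ (n - (n - i)))"
    unfolding bform_def by (rule sum.nat_diff_reindex[symmetric, of _ "Suc n", simplified lessThan_Suc_atMost, simplified])
  also have "\<dots> = bform n (reversed n p) x (t * x)"
    unfolding bform_def by (intro sum.cong refl) (auto simp: coeff_reversed power_mult_distrib mult_ac)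
  also have "\<dots> = x ^ n * poly (reversed n p) t" by (rule bform_chart[OF degree_reversed])
  finally show ?thesis .
qed

text \<open>Vanishing on the line removes the terms free of \<open>x0\<close> and \<open>x1\<close>;
  the others are divisible by \<open>x\<close> in the chart \<open>x1 = t x0\<close>. The
  coefficient of \<open>y^i z^j\<close> is a binary form of degree \<open>4 - i - j\<close>, whence
  the degree bounds. In the chart \<open>x0 = t x1\<close> the same binary forms give the reversed
  polynomials.\<close>

lemma pencil_form_exists:
  fixes F :: "'k::field poly4"
  assumes F: "homogeneous 4 F" and l: "\<And>y z. eval F (y *s u2 + z *s u3) = 0"
  obtains a11 a12 a13 a21 a22 a23 a31 a32 a33 c where
    "degree a11 \<le> 4" "degree a12 \<le> 2" "degree a13 \<le> 2" "degree a21 \<le> 3" "degree a22 \<le> 1"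
    "degree a23 \<le> 1" "degree a31 \<le> 3" "degree a32 \<le> 1" "degree a33 \<le> 1" "degree c \<le> 2"
    "pencil_form F u0 u1 u2 u3 a11 a12 a13 a21 a22 a23 a31 a32 a33 c"
    "pencil_form F u1 u0 u2 u3 (reversed 4 a11) (reversed 2 a12) (reversed 2 a13) (reversed 3 a21)
       (reversed 1 a22) (reversed 1 a23) (reversed 3 a31) (reversed 1 a32) (reversed 1 a33) (reversed 2 c)"
proof -
  obtain P where deg: "\<And>c e. c + e \<le> 4 \<Longrightarrow> degree (P c e) \<le> 4 - c - e"
    and P: "\<And>x0 x1 x2 x3. eval F (x0 *s u0 + x1 *s u1 + x2 *s u2 + x3 *s u3) =
      (\<Sum>c\<le>4. \<Sum>e\<le>4-c. bform (4-c-e) (P c e) x0 x1 * x2 ^ c * x3 ^ e)"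
    using form4_rep[OF form4_eval[OF F, of u0 u1 u2 u3]] by (elim exE conjE) blast
  have sum4: "(\<Sum>c\<le>4. \<Sum>e\<le>4-c. f c e) = f 0 0 + f 0 1 + f 0 2 + f 0 3 + f 0 4 + f 1 0 + f 1 1 + f 1 2 + f 1 3
      + f 2 0 + f 2 1 + f 2 2 + f 3 0 + f 3 1 + f 4 0" for f :: "nat \<Rightarrow> nat \<Rightarrow> 'k"
    by (simp add: eval_nat_numeral)
  define G where "G y z = coeff (P 0 4) 0 * z ^ 4 + coeff (P 1 3) 0 * y * z ^ 3 + coeff (P 2 2) 0 * y ^ 2 * z ^ 2
      + coeff (P 3 1) 0 * y ^ 3 * z + coeff (P 4 0) 0 * y ^ 4" for y z
  define R where "R x0 x1 y z = bform 4 (P 0 0) x0 x1 + bform 3 (P 0 1) x0 x1 * z + bform 2 (P 0 2) x0 x1 * z ^ 2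
      + bform 1 (P 0 3) x0 x1 * z ^ 3 + bform 3 (P 1 0) x0 x1 * y + bform 2 (P 1 1) x0 x1 * y * z
      + bform 1 (P 1 2) x0 x1 * y * z ^ 2 + bform 2 (P 2 0) x0 x1 * y ^ 2 + bform 1 (P 2 1) x0 x1 * y ^ 2 * z
      + bform 1 (P 3 0) x0 x1 * y ^ 3" for x0 x1 y z
  have b0: "bform 0 p x0 x1 = coeff p 0" for p :: "'k poly" and x0 x1 by (simp add: bform_def)
  have b00: "bform n p 0 0 = 0" if "n > 0" for n and p :: "'k poly"
    unfolding bform_def using that by (intro sum.neutral) (auto simp: power_0_left)
  have RG: "eval F (x0 *s u0 + x1 *s u1 + y *s u2 + z *s u3) = R x0 x1 y z + G y z" for x0 x1 y z
    unfolding P sum4 R_def G_def by (simp add: b0)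
  have "G y z = 0" for y z
    using RG[of 0 0 y z] l[of y z] by (simp add: R_def b00)
  hence R: "eval F (x0 *s u0 + x1 *s u1 + y *s u2 + z *s u3) = R x0 x1 y z" for x0 x1 y z
    using RG by simp
  have deg': "degree (P 0 0) \<le> 4" "degree (P 2 0) \<le> 2" "degree (P 0 2) \<le> 2" "degree (P 1 0) \<le> 3" "degree (P 3 0) \<le> 1"
    "degree (P 1 2) \<le> 1" "degree (P 0 1) \<le> 3" "degree (P 2 1) \<le> 1" "degree (P 0 3) \<le> 1" "degree (P 1 1) \<le> 2"
    using deg[of 0 0] deg[of 2 0] deg[of 0 2] deg[of 1 0] deg[of 3 0] deg[of 1 2] deg[of 0 1] deg[of 2 1]
      deg[of 0 3] deg[of 1 1] by simp_all
  show thesis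
  proof (rule that[OF deg'])
    show "pencil_form F u0 u1 u2 u3 (P 0 0) (P 2 0) (P 0 2) (P 1 0) (P 3 0) (P 1 2) (P 0 1) (P 2 1) (P 0 3) (P 1 1)"
      unfolding pencil_form_def R R_def deg'[THEN bform_chart] cubic_form_def
      by (simp add: algebra_simps power2_eq_square power3_eq_cube power4_eq_xxxx)
    show "pencil_form F u1 u0 u2 u3 (reversed 4 (P 0 0)) (reversed 2 (P 2 0)) (reversed 2 (P 0 2)) (reversed 3 (P 1 0))
       (reversed 1 (P 3 0)) (reversed 1 (P 1 2)) (reversed 3 (P 0 1)) (reversed 1 (P 2 1)) (reversed 1 (P 0 3)) (reversed 2 (P 1 1))"
      unfolding pencil_form_def
    proof (intro allI)
      fix t x y z
      have "x *s u1 + (t * x) *s u0 + y *s u2 + z *s u3 = (t * x) *s u0 + x *s u1 + y *s u2 + z *s u3" by simp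
      thus "eval F (x *s u1 + (t * x) *s u0 + y *s u2 + z *s u3) = x * cubic_form (poly (reversed 4 (P 0 0)) t)
        (poly (reversed 2 (P 2 0)) t) (poly (reversed 2 (P 0 2)) t) (poly (reversed 3 (P 1 0)) t) (poly (reversed 1 (P 3 0)) t)
        (poly (reversed 1 (P 1 2)) t) (poly (reversed 3 (P 0 1)) t) (poly (reversed 1 (P 2 1)) t) (poly (reversed 1 (P 0 3)) t)
        (poly (reversed 2 (P 1 1)) t) x y z"
        by (simp only: R R_def bform_chart_reversed cubic_form_def)
           (simp add: algebra_simps power2_eq_square power3_eq_cube power4_eq_xxxx)
    qed
  qed
qed

text \<open>The parametrization misses the plane spanned by \<open>u1\<close>, \<open>u2\<close>,
  \<open>u3\<close>. This is harmless, since quasi-ellipticity concerns all but finitely many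
  planes.\<close>

definition pencil_plane :: "'k::field ^ 4 \<Rightarrow> 'k ^ 4 \<Rightarrow> 'k ^ 4 \<Rightarrow> 'k ^ 4 \<Rightarrow> 'k \<Rightarrow> ('k ^ 4) set" where
  "pencil_plane u0 u1 u2 u3 t = {x *s u0 + (t * x) *s u1 + y *s u2 + z *s u3 | x y z. True}"

text \<open>On the plane, the equation \<open>M\<close> of the line is a nonzero multiple
  \<open>m x\<close> of the first coordinate. Hence \<open>m Q\<close> is the cubic of
  \<open>pencil_form\<close>, whichever equation \<open>Q\<close> was chosen, and a singular point
  of \<open>Q\<close> is a critical point.\<close>

lemma singular_residual_cubic:
  fixes F :: "'k::alg_closed_field poly4"
  assumes two: "(2::'k) = 0" and basis: "is_basis4 u0 u1 u2 u3" and l: "l = {y *s u2 + z *s u3 | y z. True}"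
    and form: "pencil_form F u0 u1 u2 u3 a11 a12 a13 a21 a22 a23 a31 a32 a33 c"
    and res: "residual_cubic F l (pencil_plane u0 u1 u2 u3 t) Q"
    and sing: "singular_plane_curve (pencil_plane u0 u1 u2 u3 t) Q"
  shows "\<exists>x y z. (x, y, z) \<noteq> (0, 0, 0) \<and> cubic_critical (poly a11 t) (poly a12 t) (poly a13 t) (poly a21 t)
      (poly a22 t) (poly a23 t) (poly a31 t) (poly a32 t) (poly a33 t) (poly c t) x y z"
proof -
  let ?H = "pencil_plane u0 u1 u2 u3 t"
  define w where "w = u0 + t *s u1"
  define q where "q x y z = cubic_form (poly a11 t) (poly a12 t) (poly a13 t) (poly a21 t) (poly a22 t) (poly a23 t)
        (poly a31 t) (poly a32 t) (poly a33 t) (poly c t) x y z" for x y z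
  have pt: "x *s u0 + (t * x) *s u1 + y *s u2 + z *s u3 = x *s w + y *s u2 + z *s u3" for x y z
    unfolding w_def by (simp add: vec_eq_iff algebra_simps)
  have H: "?H = {x *s w + y *s u2 + z *s u3 | x y z. True}"
    unfolding pencil_plane_def pt ..
  have inH: "x *s w + y *s u2 + z *s u3 \<in> ?H" for x y z unfolding H by blast
  have F: "eval F (x *s w + y *s u2 + z *s u3) = x * q x y z" for x y z
    unfolding pt[symmetric] q_def using form unfolding pencil_form_def by blast
  obtain L M where M: "homogeneous 1 M" and HL: "?H = {P. eval L P = 0}" and lM: "l = {P \<in> ?H. eval M P = 0}"
    and dvd: "L dvd (F - M * Q)"
    using res unfolding residual_cubic_def by blast
  from dvd obtain K where "F - M * Q = L * K" by blast
  hence FMQ: "eval F P = eval M P * eval Q P" if "P \<in> ?H" for P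
  proof -
    have "eval (F - M * Q) P = eval L P * eval K P" unfolding \<open>F - M * Q = L * K\<close> by (rule eval_mult)
    moreover have "eval L P = 0" using that HL by blast
    ultimately show ?thesis by (simp add: eval_diff eval_mult)
  qed
  define m where "m = eval M w"
  have "u2 \<in> l" unfolding l by (intro CollectI exI[of _ 1] exI[of _ 0]) simp
  hence M2: "eval M u2 = 0" using lM by blast
  have "u3 \<in> l" unfolding l by (intro CollectI exI[of _ 0] exI[of _ 1]) simp
  hence M3: "eval M u3 = 0" using lM by blast
  have m: "m \<noteq> 0"
  proof
    assume "m = 0"
    moreover have "w \<in> ?H" using inH[of 1 0 0] by simp
    ultimately have "w \<in> l" using lM unfolding m_def by blast
    then obtain y z where "w = y *s u2 + z *s u3" unfolding l by blast
    hence "1 *s u0 + t *s u1 + (-y) *s u2 + (-z) *s u3 = 0" unfolding w_def by (simp add: vec_eq_iff algebra_simps)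
    thus False using basis unfolding is_basis4_def by (metis one_neq_zero)
  qed
  have mQ': "m * eval Q (x *s w + y *s u2 + z *s u3) = q x y z" if "x \<noteq> 0" for x y z
  proof -
    have "x * q x y z = (x * m) * eval Q (x *s w + y *s u2 + z *s u3)"
      unfolding F[symmetric] FMQ[OF inH] eval_linear[OF M] M2 M3 m_def by simp
    thus ?thesis using that by simp
  qed
  \<comment> \<open>Cancelling \<open>x\<close> is only possible off the line. At a point of the
    line, both sides are polynomials along the direction \<open>w\<close> and agree for all
    \<open>s\<close> other than 0.\<close>
  have mQ: "m * eval Q (x *s w + y *s u2 + z *s u3) = q x y z" for x y z
  proof (cases "x = 0")
    case True
    obtain r where r: "\<And>s. eval Q ((y *s u2 + z *s u3) + s *s w) = poly r s"
      using eval_on_line[of Q "y *s u2 + z *s u3" w] by metis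
    \<comment> \<open>\<open>cubic_form_line\<close> from \<open>(0, y, z)\<close> in direction
      \<open>(1, 0, 0)\<close>, left unsimplified so that it matches literally.\<close>
    define r' where "r' = [: q 0 y z, 1 * (poly a11 t * 0\<^sup>2 + poly a12 t * y\<^sup>2 + poly a13 t * z\<^sup>2 + poly c t * (y * z)) +
       0 * (poly a21 t * 0\<^sup>2 + poly a22 t * y\<^sup>2 + poly a23 t * z\<^sup>2 + poly c t * (0 * z)) +
       0 * (poly a31 t * 0\<^sup>2 + poly a32 t * y\<^sup>2 + poly a33 t * z\<^sup>2 + poly c t * (0 * y)),
       0 * (poly a11 t * 1\<^sup>2 + poly a12 t * 0\<^sup>2 + poly a13 t * 0\<^sup>2) + y * (poly a21 t * 1\<^sup>2 + poly a22 t * 0\<^sup>2 + poly a23 t * 0\<^sup>2) +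
       z * (poly a31 t * 1\<^sup>2 + poly a32 t * 0\<^sup>2 + poly a33 t * 0\<^sup>2) + poly c t * (0 * 0 * 0 + 1 * y * 0 + 1 * 0 * z),
       q 1 0 0 :]"
    have r': "q s y z = poly r' s" for s
      using cubic_form_line[OF two, of "poly a11 t" "poly a12 t" "poly a13 t" "poly a21 t" "poly a22 t" "poly a23 t"
        "poly a31 t" "poly a32 t" "poly a33 t" "poly c t" 0 s 1 y 0 z 0]
      unfolding r'_def q_def by (simp only: mult_zero_right add_0_right mult_1_right add_0_left)
    have "smult m r = r'"
    proof (rule poly_eqI_infinite)
      show "infinite (UNIV - {0::'k})" using infinite_UNIV_alg_closed by simp
      fix s :: 'k assume "s \<in> UNIV - {0}"
      thus "poly (smult m r) s = poly r' s"
        using mQ'[of s y z] r[of s] r'[of s] by (simp add: add_ac)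
    qed
    hence "m * poly r 0 = q 0 y z" using r'[of 0] by (metis poly_smult)
    thus ?thesis using r[of 0] True by simp
  qed (rule mQ')
  from sing obtain P where P: "P \<in> ?H" "P \<noteq> 0" "eval Q P = 0" "\<And>v. v \<in> ?H \<Longrightarrow> dirderiv Q P v = 0"
    unfolding singular_plane_curve_def singular_at_def dirderiv_def by blast
  from P(1) obtain x y z where xyz: "P = x *s w + y *s u2 + z *s u3" unfolding H by blast
  have dd: "m * dirderiv Q P (x' *s w + y' *s u2 + z' *s u3) =
      x' * (poly a11 t * x\<^sup>2 + poly a12 t * y\<^sup>2 + poly a13 t * z\<^sup>2 + poly c t * (y * z)) +
      y' * (poly a21 t * x\<^sup>2 + poly a22 t * y\<^sup>2 + poly a23 t * z\<^sup>2 + poly c t * (x * z)) +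
      z' * (poly a31 t * x\<^sup>2 + poly a32 t * y\<^sup>2 + poly a33 t * z\<^sup>2 + poly c t * (x * y))" for x' y' z'
  proof -
    have "P + s *s (x' *s w + y' *s u2 + z' *s u3) = (x + s * x') *s w + (y + s * y') *s u2 + (z + s * z') *s u3" for s
      unfolding xyz by (simp add: vec_eq_iff algebra_simps)
    hence *: "m * eval Q (P + s *s (x' *s w + y' *s u2 + z' *s u3)) = q (x + s * x') (y + s * y') (z + s * z')" for s
      by (simp only: mQ)
    have "eval Q (P + s *s (x' *s w + y' *s u2 + z' *s u3)) = (1 / m) * q (x + s * x') (y + s * y') (z + s * z')" for s
      using *[of s] m by (simp add: field_simps)
    note this[unfolded q_def cubic_form_line[OF two], folded poly_smult]
    from dirderiv_eqI[OF this] show ?thesis using m by simp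
  qed
  have "dirderiv Q P (x' *s w + y' *s u2 + z' *s u3) = 0" for x' y' z' using P(4) inH by blast
  note dd = dd[unfolded this mult_zero_right]
  have "cubic_critical (poly a11 t) (poly a12 t) (poly a13 t) (poly a21 t)
      (poly a22 t) (poly a23 t) (poly a31 t) (poly a32 t) (poly a33 t) (poly c t) x y z"
    unfolding cubic_critical_def using dd[of 1 0 0] dd[of 0 1 0] dd[of 0 0 1] by simp
  moreover have "(x, y, z) \<noteq> (0, 0, 0)" using P(2) xyz by auto
  ultimately show ?thesis by blast
qed

section \<open>Linear algebra of the pencil and a basis adapted to the line\<close>

lemma pencil_plane_inj:
  assumes basis: "is_basis4 u0 u1 u2 u3"
  shows "inj (pencil_plane u0 u1 u2 u3)"
proof (rule injI)
  fix t t' assume eq: "pencil_plane u0 u1 u2 u3 t = pencil_plane u0 u1 u2 u3 t'"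
  have "1 *s u0 + (t * 1) *s u1 + 0 *s u2 + 0 *s u3 \<in> pencil_plane u0 u1 u2 u3 t"
    unfolding pencil_plane_def by blast
  then obtain x y z where "1 *s u0 + (t * 1) *s u1 + 0 *s u2 + 0 *s u3 = x *s u0 + (t' * x) *s u1 + y *s u2 + z *s u3"
    unfolding eq unfolding pencil_plane_def by blast
  hence "(1 - x) *s u0 + (t - t' * x) *s u1 + (-y) *s u2 + (-z) *s u3 = 0"
    by (simp add: vec_eq_iff algebra_simps)
  hence "1 - x = 0" "t - t' * x = 0" using basis unfolding is_basis4_def by blast+
  thus "t = t'" by simp
qed

lemma pencil_plane_in_pencil:
  assumes basis: "is_basis4 u0 u1 u2 u3" and l: "l = {y *s u2 + z *s u3 | y z. True}"
  shows "pencil_plane u0 u1 u2 u3 t \<in> pencil l"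
proof -
  define w where "w = u0 + t *s u1"
  have ind: "x0 = 0 \<and> x1 = 0 \<and> x2 = 0 \<and> x3 = 0" if "x0 *s u0 + x1 *s u1 + x2 *s u2 + x3 *s u3 = 0" for x0 x1 x2 x3
    using basis that unfolding is_basis4_def by blast
  have span: "pencil_plane u0 u1 u2 u3 t = vec.span {w, u2, u3}"
  proof (rule set_eqI)
    fix v
    have "v \<in> vec.span {w, u2, u3} \<longleftrightarrow> (\<exists>x y z. v - x *s w - y *s u2 - z *s u3 = 0)"
      by (simp add: vec.span_breakdown_eq)
    also have "\<dots> \<longleftrightarrow> (\<exists>x y z. v = x *s u0 + (t * x) *s u1 + y *s u2 + z *s u3)"
      unfolding w_def by (intro arg_cong[of _ _ Ex] ext) (auto simp: vec_eq_iff algebra_simps)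
    finally show "v \<in> pencil_plane u0 u1 u2 u3 t \<longleftrightarrow> v \<in> vec.span {w, u2, u3}"
      unfolding pencil_plane_def by blast
  qed
  have w: "w \<notin> vec.span {u2, u3}"
  proof
    assume "w \<in> vec.span {u2, u3}"
    then obtain y z where "w - y *s u2 - z *s u3 = 0" by (auto simp: vec.span_breakdown_eq)
    hence "1 *s u0 + t *s u1 + (-y) *s u2 + (-z) *s u3 = 0" unfolding w_def by (simp add: vec_eq_iff algebra_simps)
    thus False using ind by (metis one_neq_zero)
  qed
  have u2: "u2 \<notin> vec.span {u3}"
  proof
    assume "u2 \<in> vec.span {u3}"
    then obtain z where "u2 - z *s u3 = 0" by (auto simp: vec.span_breakdown_eq)
    hence "0 *s u0 + 0 *s u1 + 1 *s u2 + (-z) *s u3 = 0" by (simp add: vec_eq_iff algebra_simps)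
    thus False using ind by (metis one_neq_zero)
  qed
  have u3: "u3 \<notin> vec.span {}"
  proof
    assume "u3 \<in> vec.span {}"
    hence "0 *s u0 + 0 *s u1 + 0 *s u2 + 1 *s u3 = 0" by simp
    thus False using ind by (metis one_neq_zero)
  qed
  have "vec.independent {w, u2, u3}"
    by (intro vec.independent_insertI w u2 u3 vec.independent_empty)
  moreover have "card {w, u2, u3} = 3"
  proof -
    have "w \<notin> {u2, u3}" "u2 \<notin> {u3}" using w u2 vec.span_superset by blast+
    thus ?thesis by auto
  qed
  ultimately have "vec.dim (vec.span {w, u2, u3}) = 3" by (simp add: vec.dim_eq_card_independent)
  hence "is_plane (pencil_plane u0 u1 u2 u3 t)" unfolding is_plane_def span by simp
  moreover have "l \<subseteq> pencil_plane u0 u1 u2 u3 t"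
  proof
    fix v assume "v \<in> l"
    then obtain y z where "v = y *s u2 + z *s u3" unfolding l by blast
    hence "v = 0 *s u0 + (t * 0) *s u1 + y *s u2 + z *s u3" by simp
    thus "v \<in> pencil_plane u0 u1 u2 u3 t" unfolding pencil_plane_def by blast
  qed
  ultimately show ?thesis unfolding pencil_def by blast
qed

lemma adapted_basis_exists:
  fixes l :: "('k::field ^ 4) set"
  assumes "is_line l"
  obtains u0 u1 u2 u3 where "is_basis4 u0 u1 u2 u3" "l = {y *s u2 + z *s u3 | y z. True}"
proof -
  have sub: "vec.subspace l" and dim: "vec.dim l = 2" using assms unfolding is_line_def by auto
  obtain B where B: "B \<subseteq> l" "vec.independent B" "l \<subseteq> vec.span B" "card B = 2"
    using vec.basis_exists[of l] dim by metis
  obtain u2 u3 where u23: "B = {u2, u3}" "u2 \<noteq> u3" using B(4) by (auto simp: card_2_iff)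
  define E where "E = vec.extend_basis B"
  have E: "B \<subseteq> E" "vec.independent E" "vec.span E = UNIV"
    unfolding E_def using vec.extend_basis_superset[OF B(2)] vec.independent_extend_basis[OF B(2)]
      vec.span_extend_basis[OF B(2)] by auto
  have "card E = vec.dim (UNIV :: ('k ^ 4) set)"
    using vec.dim_span_eq_card_independent[OF E(2)] E(3) by simp
  hence "card E = 4" by (simp add: card_cart_basis)
  moreover have "finite E" using calculation by (metis card.infinite zero_neq_numeral)
  ultimately have "card (E - B) = 2" using E(1) B(4) by (simp add: card_Diff_subset finite_subset)
  then obtain u0 u1 where u01: "E - B = {u0, u1}" "u0 \<noteq> u1" by (auto simp: card_2_iff)
  have Eeq: "E = {u0, u1, u2, u3}" using u01(1) u23(1) E(1) by blast
  have dist: "u0 \<noteq> u2" "u0 \<noteq> u3" "u1 \<noteq> u2" "u1 \<noteq> u3" using u01(1) u23(1) by blast+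
  have "is_basis4 u0 u1 u2 u3"
    unfolding is_basis4_def
  proof (intro conjI allI impI)
    fix v :: "'k ^ 4"
    have "v \<in> vec.span {u0, u1, u2, u3}" using E(3) Eeq by simp
    then obtain x0 x1 x2 x3 where "v - x0 *s u0 - x1 *s u1 - x2 *s u2 - x3 *s u3 = 0"
      by (auto simp: vec.span_breakdown_eq)
    hence "v = x0 *s u0 + x1 *s u1 + x2 *s u2 + x3 *s u3" by (simp add: vec_eq_iff algebra_simps)
    thus "\<exists>x0 x1 x2 x3. v = x0 *s u0 + x1 *s u1 + x2 *s u2 + x3 *s u3" by blast
  next
    fix x0 x1 x2 x3 assume *: "x0 *s u0 + x1 *s u1 + x2 *s u2 + x3 *s u3 = 0"
    define f where "f v = (if v = u0 then x0 else if v = u1 then x1 else if v = u2 then x2 else x3)" for v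
    have "(\<Sum>v\<in>E. f v *s v) = 0"
      unfolding Eeq using * dist u01(2) u23(2) by (simp add: f_def add_ac)
    hence "\<forall>v\<in>E. f v = 0"
      using E(2) vec.dependent_finite[of E] \<open>finite E\<close> by blast
    hence "f u0 = 0" "f u1 = 0" "f u2 = 0" "f u3 = 0" unfolding Eeq by auto
    thus "x0 = 0" "x1 = 0" "x2 = 0" "x3 = 0" using dist u01(2) u23(2) by (auto simp: f_def)
  qed
  moreover have "l = {y *s u2 + z *s u3 | y z. True}"
  proof -
    have "l = vec.span B" using B(1,3) vec.span_minimal[OF B(1) sub] by blast
    also have "\<dots> = {y *s u2 + z *s u3 | y z. True}"
    proof (rule set_eqI)
      fix v
      have "v \<in> vec.span B \<longleftrightarrow> (\<exists>y z. v - y *s u2 - z *s u3 = 0)"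
        unfolding u23 by (simp add: vec.span_breakdown_eq)
      also have "\<dots> \<longleftrightarrow> (\<exists>y z. v = y *s u2 + z *s u3)"
        by (intro arg_cong[of _ _ Ex] ext) (auto simp: vec_eq_iff algebra_simps)
      finally show "v \<in> vec.span B \<longleftrightarrow> v \<in> {y *s u2 + z *s u3 | y z. True}" by blast
    qed
    finally show ?thesis .
  qed
  ultimately show thesis by (rule that)
qed

theorem proposition2p1:
  fixes F :: "'k::alg_closed_field poly4" and l :: "('k ^ 4) set"
  assumes "CHAR('k) = 2"
    and "smooth_quartic F"
    and "is_line l"
    and "\<forall>P\<in>l. eval F P = 0"
  shows "\<not> quasi_elliptic (pencil l) (genus_one_fibration F l)"
proof
  assume qe: "quasi_elliptic (pencil l) (genus_one_fibration F l)"
  have two: "(2::'k) = 0"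
    using of_nat_CHAR[where 'a = 'k] assms(1) by simp
  obtain u0 u1 u2 u3 where basis: "is_basis4 u0 u1 u2 u3" and l: "l = {y *s u2 + z *s u3 | y z. True}"
    using adapted_basis_exists[OF assms(3)] .
  have "homogeneous 4 F" using assms(2) unfolding smooth_quartic_def by blast
  moreover have "eval F (y *s u2 + z *s u3) = 0" for y z using assms(4) l by blast
  ultimately obtain a11 a12 a13 a21 a22 a23 a31 a32 a33 c where
    deg: "degree a11 \<le> 4" "degree a12 \<le> 2" "degree a13 \<le> 2" "degree a21 \<le> 3" "degree a22 \<le> 1"
    "degree a23 \<le> 1" "degree a31 \<le> 3" "degree a32 \<le> 1" "degree a33 \<le> 1" "degree c \<le> 2"
    and form: "pencil_form F u0 u1 u2 u3 a11 a12 a13 a21 a22 a23 a31 a32 a33 c"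
    and form': "pencil_form F u1 u0 u2 u3 (reversed 4 a11) (reversed 2 a12) (reversed 2 a13) (reversed 3 a21)
       (reversed 1 a22) (reversed 1 a23) (reversed 3 a31) (reversed 1 a32) (reversed 1 a33) (reversed 2 c)"
    by (rule pencil_form_exists[of F u2 u3 u0 u1])
  \<comment> \<open>\<open>T\<close> is the set of parameters with a singular fiber. Distinct
    parameters give distinct planes, so its complement is finite.\<close>
  define T where "T = {t. \<exists>Q. residual_cubic F l (pencil_plane u0 u1 u2 u3 t) Q \<and>
    singular_plane_curve (pencil_plane u0 u1 u2 u3 t) Q}"
  have "pencil_plane u0 u1 u2 u3 ` (- T) \<subseteq> {H \<in> pencil l. \<not> (\<exists>Q\<in>genus_one_fibration F l H. singular_plane_curve H Q)}"
    using pencil_plane_in_pencil[OF basis l] unfolding T_def genus_one_fibration_def by blast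
  hence "finite (pencil_plane u0 u1 u2 u3 ` (- T))"
    using qe unfolding quasi_elliptic_def by (rule finite_subset)
  hence "finite (- T)"
    using pencil_plane_inj[OF basis] finite_imageD inj_on_subset subset_UNIV by metis
  hence T: "infinite T"
    using infinite_UNIV_alg_closed[where 'a = 'k] finite_Un[of T "- T"] by (simp add: Compl_partition)
  have sing: "\<exists>x y z. (x, y, z) \<noteq> (0, 0, 0) \<and> cubic_critical (poly a11 t) (poly a12 t) (poly a13 t) (poly a21 t)
      (poly a22 t) (poly a23 t) (poly a31 t) (poly a32 t) (poly a33 t) (poly c t) x y z" if "t \<in> T" for t
    using singular_residual_cubic[OF two basis l form] that unfolding T_def by blast
  note contra = singular_point_contradiction[OF two assms(2) basis form deg(5,6,8,9)]
  show False
  proof (cases "c = 0")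
    case False
    show False using nodal[OF two T False sing] contra by blast
  next
    case True
    \<comment> \<open>For \<open>c = 0\<close> the squares of the coordinates of a singular point
      form a nonzero kernel vector, so the determinant vanishes at infinitely many
      \<open>t\<close>.\<close>
    define D where "D = a11 * (a22 * a33 - a23 * a32) - a12 * (a21 * a33 - a23 * a31) + a13 * (a21 * a32 - a22 * a31)"
    have "poly D t = 0" if "t \<in> T" for t
    proof -
      obtain x y z where nz: "(x, y, z) \<noteq> (0, 0, 0)" and s: "cubic_critical (poly a11 t) (poly a12 t) (poly a13 t) (poly a21 t)
        (poly a22 t) (poly a23 t) (poly a31 t) (poly a32 t) (poly a33 t) (poly c t) x y z"
        using sing[OF \<open>t \<in> T\<close>] by blast
      have e: "poly a11 t * x\<^sup>2 + poly a12 t * y\<^sup>2 + poly a13 t * z\<^sup>2 = 0"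
        "poly a21 t * x\<^sup>2 + poly a22 t * y\<^sup>2 + poly a23 t * z\<^sup>2 = 0"
        "poly a31 t * x\<^sup>2 + poly a32 t * y\<^sup>2 + poly a33 t * z\<^sup>2 = 0"
        using s unfolding cubic_critical_def True by simp_all
      have "poly D t * x\<^sup>2 = 0" "poly D t * y\<^sup>2 = 0" "poly D t * z\<^sup>2 = 0"
        using e unfolding D_def by (simp_all, algebra+)
      thus ?thesis using nz by auto
    qed
    hence "D = 0" by (intro poly_eq_0_if_infinite_roots[OF T])
    note cusp = cuspidal[OF two deg(1-9) this[unfolded D_def]]
    from cusp show False
    proof (elim disjE exE conjE)
      fix t x y z
      assume "(x, y, z) \<noteq> (0, 0, 0)"
        "cubic_critical (poly a11 t) (poly a12 t) (poly a13 t) (poly a21 t)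
          (poly a22 t) (poly a23 t) (poly a31 t) (poly a32 t) (poly a33 t) 0 x y z"
        "cubic_form (poly (pderiv a11) t) (poly (pderiv a12) t) (poly (pderiv a13) t) (poly (pderiv a21) t)
          (poly (pderiv a22) t) (poly (pderiv a23) t) (poly (pderiv a31) t) (poly (pderiv a32) t)
          (poly (pderiv a33) t) 0 x y z = 0"
      thus False using contra[of x y z t] True by simp
    next
      fix x y z
      assume *: "(x, y, z) \<noteq> (0, 0, 0)"
        "cubic_critical (coeff a11 4) (coeff a12 2) (coeff a13 2) (coeff a21 3)
          (coeff a22 1) (coeff a23 1) (coeff a31 3) (coeff a32 1) (coeff a33 1) 0 x y z"
        "cubic_form (coeff a11 3) (coeff a12 1) (coeff a13 1) (coeff a21 2)
          (coeff a22 0) (coeff a23 0) (coeff a31 2) (coeff a32 0) (coeff a33 0) 0 x y z = 0"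
      \<comment> \<open>Exchanging \<open>u0\<close> and \<open>u1\<close> moves the plane at
        infinity to parameter 0, where the reversed polynomials have the two top coefficients as
        value and derivative.\<close>
      have basis': "is_basis4 u1 u0 u2 u3"
        using basis unfolding is_basis4_def by (metis add.commute)
      show False
        by (rule singular_point_contradiction[OF two assms(2) basis' form' degree_reversed degree_reversed
          degree_reversed degree_reversed *(1), of 0])
          (use *(2,3) True in \<open>simp_all add: poly_reversed_0 poly_pderiv_reversed_0\<close>)
    qed
  qed
qed

end
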